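(* Let $p,q\ge 0$ be integers with $n=p+q>2$. Then the Lie subalgebra $\mathit{so}(p+1,q+1)=(\mathbb{R}^n\oplus \mathit{so}(p,q,\mathbb{R})\oplus\mathbb{R}\,\mathrm{Id}\oplus\mathbb{R}^{n*})^*$ of $\mathrm{Vect}_*(\mathbb{R}^n)$ is maximal in $\mathrm{Vect}_*(\mathbb{R}^n)$; that is, the only Lie subalgebra of $\mathrm{Vect}_*(\mathbb{R}^n)$ strictly larger than it is $\mathrm{Vect}_*(\mathbb{R}^n)$ itself.
   Context: $\mathrm{Vect}_*(\mathbb{R}^n)$ is the real Lie algebra of vector fields on $\mathbb{R}^n$ with real polynomial components, with the usual bracket. Let $a_1=\dots=a_p=1$ and $a_{p+1}=\dots=a_n=-1$, where $n=p+q$, and let $g=\sum_{i=1}^n a_i(dx^i)^2$. $\mathit{so}(p,q,\mathbb{R})$ is the Lie algebra of real $n\times n$ matrices that are skew with respect to $g$, and $\mathrm{Id}$ is the identity matrix. For $h\in\mathbb{R}^n$, $A\in \mathit{gl}(n,\mathbb{R})$ and $\alpha\in\mathbb{R}^{n*}$ define the polynomial vector fields \[ h^*=-\sum_i h^i\partial_i,\qquad A^*=-\sum_{i,j}A^i_jx^j\partial_i,\qquad \alpha^*=\alpha(x)\sum_i x^i\partial_i-\frac12\Big(\sum_i a_i(x^i)^2\Big)\alpha^\sharp, \] where $\alpha^\sharp=\sum_i a_i\alpha_i\partial_i$. The space $(\mathbb{R}^n\oplus \mathit{so}(p,q,\mathbb{R})\oplus\mathbb{R}\,\mathrm{Id}\oplus\mathbb{R}^{n*})^*$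 is the set of all vector fields $h^*+A^*+\alpha^*$ with $h\in\mathbb{R}^n$, $A\in \mathit{so}(p,q,\mathbb{R})\oplus\mathbb{R}\,\mathrm{Id}$, $\alpha\in\mathbb{R}^{n*}$. It is a Lie subalgebra of $\mathrm{Vect}_*(\mathbb{R}^n)$ isomorphic to the abstract Lie algebra $\mathit{so}(p+1,q+1,\mathbb{R})$, and is denoted $\mathit{so}(p+1,q+1)$. *)

theory Defs
  imports "HOL-Analysis.Analysis"
begin

type_synonym 'n vec_field = "real^'n \<Rightarrow> real^'n"

definition poly_vec_fields :: "('n::finite) vec_field set" where
  "poly_vec_fields = {X. \<forall>i. real_polynomial_function (\<lambda>x. X x $ i)}"

(* In coordinates: [X,Y]^i = sum_j (X^j d_j Y^i - Y^j d_j X^i). *)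
definition vf_bracket :: "('n::finite) vec_field \<Rightarrow> 'n vec_field \<Rightarrow> 'n vec_field" where
  "vf_bracket X Y =
    (\<lambda>x. frechet_derivative Y (at x) (X x) - frechet_derivative X (at x) (Y x))"

definition lie_subalgebra :: "('n::finite) vec_field set \<Rightarrow> bool" where
  "lie_subalgebra L \<longleftrightarrow>
     L \<subseteq> poly_vec_fields \<and>
     (\<lambda>x. 0) \<in> L \<and>
     (\<forall>X\<in>L. \<forall>Y\<in>L. (\<lambda>x. X x + Y x) \<in> L) \<and>
     (\<forall>c::real. \<forall>X\<in>L. (\<lambda>x. c *\<^sub>R X x) \<in> L) \<and>
     (\<forall>X\<in>L. \<forall>Y\<in>L. vf_bracket X Y \<in> L)"

definition maximal_lie_subalgebra :: "('n::finite) vec_field set \<Rightarrow> bool" where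
  "maximal_lie_subalgebra S \<longleftrightarrow>
     lie_subalgebra S \<and> S \<subset> poly_vec_fields \<and>
     (\<forall>L. lie_subalgebra L \<and> S \<subset> L \<longrightarrow> L = poly_vec_fields)"

(* The numbering idx of the coordinates by 1, ..., n is needed because the index type 'n
   carries no order of its own. *)
definition signature_coeff :: "nat \<Rightarrow> ('n \<Rightarrow> nat) \<Rightarrow> 'n \<Rightarrow> real" where
  "signature_coeff p idx i = (if idx i \<le> p then 1 else - 1)"

definition metric :: "('n::finite \<Rightarrow> real) \<Rightarrow> real^'n \<Rightarrow> real^'n \<Rightarrow> real" where
  "metric a u v = (\<Sum>i\<in>UNIV. a i * u $ i * v $ i)"

definition so_matrices :: "('n::finite \<Rightarrow> real) \<Rightarrow> (real^'n^'n) set" where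
  "so_matrices a = {A. \<forall>u v. metric a (A *v u) v + metric a u (A *v v) = 0}"

definition co_matrices :: "('n::finite \<Rightarrow> real) \<Rightarrow> (real^'n^'n) set" where
  "co_matrices a = {B + c *\<^sub>R mat 1 | B c. B \<in> so_matrices a}"

definition const_vf :: "real^'n \<Rightarrow> ('n::finite) vec_field" where
  "const_vf h = (\<lambda>x. - h)"

definition linear_vf :: "real^'n^'n \<Rightarrow> ('n::finite) vec_field" where
  "linear_vf A = (\<lambda>x. - (A *v x))"

definition sharp :: "('n::finite \<Rightarrow> real) \<Rightarrow> (real^'n \<Rightarrow> real) \<Rightarrow> real^'n" where
  "sharp a \<alpha> = (\<chi> i. a i * \<alpha> (axis i 1))"

definition quadratic_vf ::
    "('n::finite \<Rightarrow> real) \<Rightarrow> (real^'n \<Rightarrow> real) \<Rightarrow> 'n vec_field" where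
  "quadratic_vf a \<alpha> =
    (\<lambda>x. \<alpha> x *\<^sub>R x - (1/2 * (\<Sum>i\<in>UNIV. a i * (x $ i)\<^sup>2)) *\<^sub>R sharp a \<alpha>)"

definition conformal_algebra :: "('n::finite \<Rightarrow> real) \<Rightarrow> 'n vec_field set" where
  "conformal_algebra a =
    {\<lambda>x. const_vf h x + linear_vf A x + quadratic_vf a \<alpha> x | h A \<alpha>.
       A \<in> co_matrices a \<and> linear \<alpha>}"

end

theory Submission imports Defs begin

text \<open>
  A Lie algebra \<open>L\<close> containing the conformal algebra contains the constant fields, hence is closed
  under directional derivatives. If every linear field in \<open>L\<close> is conformal, induction on the degree
  shows that \<open>L\<close> is the conformal algebra: a polynomial field all of whose derivatives are conformal
  is affine plus a conformal quadratic field, because for \<open>n > 2\<close> the first prolongation of the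
  conformal matrices consists of the quadratic fields and the second one is zero.
  Otherwise \<open>L\<close> contains a linear field that is not conformal. Its commutators with the plane
  rotations then produce all linear fields, as trace-free \<open>g\<close>-symmetric matrices form an irreducible
  representation. Bracketing \<open>x\<^sub>j \<partial>\<^sub>j\<close> with the quadratic fields gives
  \<open>x\<^sub>j\<^sup>2 \<partial>\<^sub>i\<close>, from which all quadratic fields arise, and these raise the degree
  indefinitely.
\<close>

section \<open>Directional derivatives of polynomial fields\<close>

text \<open>The conformal algebra is graded in degrees -1, 0, 1 (constant, linear, quadratic
  fields), and the linear fields of \<open>L\<close> decide everything: their matrices form a Lie
  algebra containing the conformal matrices, and these are maximal among all matrices. Two obstacles
  shape the proof. And bracketing with \<open>x_j E\<close>, \<open>E\<close> the Euler field,
  raises the degree with a factor \<open>d - 1\<close> that vanishes at \<open>d = 1\<close>: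
  quadratic fields must be obtained from the conformal ones, while the step from any other degree is
  uniform. The dimension bound acts through a third index, needed both for the vanishing second
  prolongation and for separating diagonal from off-diagonal parts in a plane.\<close>

definition dderiv ::
    "'a::real_normed_vector \<Rightarrow> ('a \<Rightarrow> 'b::real_normed_vector) \<Rightarrow> 'a \<Rightarrow> 'b" where
  "dderiv v f = (\<lambda>x. frechet_derivative f (at x) v)"

lemma dderiv_eq:
  assumes "\<And>x. (f has_derivative f' x) (at x)"
  shows "dderiv v f = (\<lambda>x. f' x v)"
  unfolding dderiv_def using frechet_derivative_at[OF assms] by metis

lemma has_derivative_dderiv:
  assumes "f differentiable at x"
  shows "(f has_derivative (\<lambda>v. dderiv v f x)) (at x)"
  using assms by (simp add: dderiv_def frechet_derivative_works)

lemma linear_dderiv: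
  assumes "f differentiable at x"
  shows "linear (\<lambda>v. dderiv v f x)"
  using has_derivative_dderiv[OF assms] has_derivative_linear by blast

lemma dderiv_const [simp]: "dderiv v (\<lambda>x. c) = (\<lambda>x. 0)"
  by (intro dderiv_eq) simp

lemma dderiv_bounded_linear: "bounded_linear f \<Longrightarrow> dderiv v f = (\<lambda>x. f v)"
  by (intro dderiv_eq) (rule bounded_linear_imp_has_derivative)

lemma dderiv_bounded_linear_compose:
  assumes "bounded_linear h" "\<And>x. f differentiable at x"
  shows "dderiv v (\<lambda>x. h (f x)) = (\<lambda>x. h (dderiv v f x))"
  by (intro dderiv_eq bounded_linear.has_derivative[OF assms(1)] has_derivative_dderiv assms(2))

lemma dderiv_add:
  assumes "\<And>x. f differentiable at x" "\<And>x. g differentiable at x"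
  shows "dderiv v (\<lambda>x. f x + g x) = (\<lambda>x. dderiv v f x + dderiv v g x)"
  by (intro dderiv_eq has_derivative_add has_derivative_dderiv assms)

lemma dderiv_diff:
  assumes "\<And>x. f differentiable at x" "\<And>x. g differentiable at x"
  shows "dderiv v (\<lambda>x. f x - g x) = (\<lambda>x. dderiv v f x - dderiv v g x)"
  by (intro dderiv_eq has_derivative_diff has_derivative_dderiv assms)

lemma dderiv_mult:
  fixes f g :: "'a::real_normed_vector \<Rightarrow> real"
  assumes "\<And>x. f differentiable at x" "\<And>x. g differentiable at x"
  shows "dderiv v (\<lambda>x. f x * g x) = (\<lambda>x. f x * dderiv v g x + dderiv v f x * g x)"
  by (intro dderiv_eq has_derivative_mult has_derivative_dderiv assms)

lemma dderiv_coordinate [simp]: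
  "dderiv v (\<lambda>x::real^'n. x $ j) = (\<lambda>x. v $ j)"
  by (intro dderiv_bounded_linear bounded_linear_vec_nth)

lemma real_polynomial_function_coordinate: "real_polynomial_function (\<lambda>x::real^'n. x $ i)"
  by (simp add: bounded_linear_vec_nth real_polynomial_function.intros(1))

lemma real_polynomial_function_dderiv:
  fixes f :: "'a::euclidean_space \<Rightarrow> real"
  shows "real_polynomial_function f \<Longrightarrow> real_polynomial_function (dderiv v f)"
proof (induction rule: real_polynomial_function.induct)
  case (linear f)
  then show ?case by (simp add: dderiv_bounded_linear real_polynomial_function.intros(2))
qed (auto simp: dderiv_add dderiv_mult differentiable_at_real_polynomial_function)

lemma polynomial_function_dderiv:
  fixes f :: "'a::euclidean_space \<Rightarrow> 'b::euclidean_space"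
  assumes "polynomial_function f"
  shows "polynomial_function (dderiv v f)"
  unfolding polynomial_function_def
proof (intro allI impI)
  fix h :: "'b \<Rightarrow> real" assume h: "bounded_linear h"
  have "h \<circ> dderiv v f = dderiv v (h \<circ> f)"
    using dderiv_bounded_linear_compose[OF h differentiable_at_polynomial_function[OF assms]]
    by (simp add: o_def)
  then show "real_polynomial_function (h \<circ> dderiv v f)"
    using assms h real_polynomial_function_dderiv by (metis polynomial_function_def)
qed

text \<open>Structural induction: linear maps and constants have vanishing second derivatives, and
  the Leibniz rule leaves an expression symmetric in \<open>u\<close> and \<open>v\<close>.\<close>

lemma dderiv_commute_real:
  fixes f :: "'a::euclidean_space \<Rightarrow> real"
  shows "real_polynomial_function f \<Longrightarrow> dderiv u (dderiv v f) = dderiv v (dderiv u f)"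
proof (induction rule: real_polynomial_function.induct)
  case (linear f)
  then show ?case by (simp add: dderiv_bounded_linear)
next
  case (const c)
  then show ?case by simp
next
  case (add f g)
  then show ?case
    by (simp add: dderiv_add differentiable_at_real_polynomial_function
        real_polynomial_function_dderiv)
next
  case (mult f g)
  then show ?case
    by (simp add: dderiv_add dderiv_mult differentiable_at_real_polynomial_function
        real_polynomial_function_dderiv real_polynomial_function.intros(4) algebra_simps)
qed

lemma dderiv_commute:
  fixes f :: "'a::euclidean_space \<Rightarrow> 'b::euclidean_space"
  assumes "polynomial_function f"
  shows "dderiv u (dderiv v f) = dderiv v (dderiv u f)"
proof
  fix x
  have *: "dderiv u (dderiv v f) x \<bullet> b = dderiv u (dderiv v (\<lambda>x. f x \<bullet> b)) x" for u v b
    using dderiv_bounded_linear_compose[OF bounded_linear_inner_left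
        differentiable_at_polynomial_function[OF assms]]
      dderiv_bounded_linear_compose[OF bounded_linear_inner_left
        differentiable_at_polynomial_function[OF polynomial_function_dderiv[OF assms]]]
    by metis
  have "real_polynomial_function (\<lambda>x. f x \<bullet> b)" for b
    using assms bounded_linear_inner_left[of b] by (auto simp: polynomial_function_def o_def)
  then show "dderiv u (dderiv v f) x = dderiv v (dderiv u f) x"
    by (metis "*" dderiv_commute_real euclidean_eqI)
qed

text \<open>For polynomials this is "degree less than \<open>d\<close>", phrased by iterated
  derivatives so that no monomial basis is needed. The strict bound puts the zero function at level
  0 and nonzero constants at level 1.\<close>

primrec degree_below ::
    "nat \<Rightarrow> ('a::real_normed_vector \<Rightarrow> 'b::real_normed_vector) \<Rightarrow> bool" where
  "degree_below 0 f \<longleftrightarrow> f = (\<lambda>x. 0)"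
| "degree_below (Suc d) f \<longleftrightarrow> (\<forall>v. degree_below d (dderiv v f))"

lemma degree_below_zero: "degree_below d (\<lambda>x. 0)"
  by (induction d) auto

lemma degree_below_Suc: "degree_below d f \<Longrightarrow> degree_below (Suc d) f"
proof (induction d arbitrary: f)
  case 0
  then show ?case by (simp)
qed auto

lemma degree_below_mono: "degree_below d f \<Longrightarrow> d \<le> e \<Longrightarrow> degree_below e f"
  by (rule lift_Suc_mono_le[where f="\<lambda>d. degree_below d f", simplified le_bool_def, rule_format])
    (use degree_below_Suc in blast)+

lemma degree_below_add:
  fixes f g :: "'a::euclidean_space \<Rightarrow> real"
  shows "\<lbrakk>real_polynomial_function f; real_polynomial_function g;
     degree_below d f; degree_below d g\<rbrakk> \<Longrightarrow> degree_below d (\<lambda>x. f x + g x)"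
  by (induction d arbitrary: f g)
    (auto simp: dderiv_add differentiable_at_real_polynomial_function real_polynomial_function_dderiv)

text \<open>The bound \<open>d + e\<close> is not sharp, but it fits the Leibniz rule: each summand
  lowers exactly one of the two levels. Level 0 cannot be lowered, but there the product is
  zero.\<close>

lemma degree_below_mult:
  fixes f g :: "'a::euclidean_space \<Rightarrow> real"
  shows "\<lbrakk>real_polynomial_function f; real_polynomial_function g;
     degree_below d f; degree_below e g\<rbrakk> \<Longrightarrow> degree_below (d + e) (\<lambda>x. f x * g x)"
proof (induction "d + e" arbitrary: d e f g)
  case 0
  then show ?case by simp
next
  case (Suc k)
  show ?case
  proof (cases "d = 0 \<or> e = 0")
    case True
    then have "(\<lambda>x. f x * g x) = (\<lambda>x. 0)" using Suc.prems by auto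
    then show ?thesis by (simp only: degree_below_zero)
  next
    case False
    then obtain d' e' where de: "d = Suc d'" "e = Suc e'" by (metis not0_implies_Suc)
    have "degree_below k (\<lambda>x. f x * dderiv v g x)" "degree_below k (\<lambda>x. dderiv v f x * g x)" for v
      using Suc.hyps(1)[of d e' f "dderiv v g"] Suc.hyps(1)[of d' e "dderiv v f" g] Suc.prems Suc.hyps(2) de
      by (auto simp: real_polynomial_function_dderiv)
    then have "degree_below (Suc k) (\<lambda>x. f x * g x)"
      using Suc.prems
      by (auto simp: dderiv_mult differentiable_at_real_polynomial_function
          intro!: degree_below_add real_polynomial_function_dderiv)
    then show ?thesis using Suc.hyps(2) by simp
  qed
qed

lemma real_polynomial_function_degree_below:
  fixes f :: "'a::euclidean_space \<Rightarrow> real"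
  shows "real_polynomial_function f \<Longrightarrow> \<exists>d. degree_below d f"
proof (induction rule: real_polynomial_function.induct)
  case (linear f)
  then have "degree_below 2 f" by (simp add: numeral_2_eq_2 dderiv_bounded_linear)
  then show ?case by blast
next
  case (const c)
  have "degree_below 1 (\<lambda>x::'a. c)" by (simp)
  then show ?case by blast
next
  case (add f g)
  then obtain d e where "degree_below d f" "degree_below e g" by blast
  then have "degree_below (max d e) f" "degree_below (max d e) g"
    by (auto elim: degree_below_mono)
  then show ?case using add degree_below_add by blast
next
  case (mult f g)
  then show ?case using degree_below_mult by blast
qed

section \<open>Polynomial vector fields and induction over their derivatives\<close>

lemma poly_vec_fields_iff: "X \<in> poly_vec_fields \<longleftrightarrow> polynomial_function X"
  by (auto simp: poly_vec_fields_def polynomial_function_iff_Basis_inner[of X]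
      Basis_vec_def inner_axis real_polynomial_function_eq)

lemma vec_field_differentiable: "X \<in> poly_vec_fields \<Longrightarrow> X differentiable at x"
  by (simp add: poly_vec_fields_iff differentiable_at_polynomial_function)

lemma vec_field_dderiv: "X \<in> poly_vec_fields \<Longrightarrow> dderiv v X \<in> poly_vec_fields"
  by (simp add: poly_vec_fields_iff polynomial_function_dderiv)

lemma dderiv_vec_nth:
  assumes "\<And>x. X differentiable at x"
  shows "dderiv v (\<lambda>x. X x $ i) = (\<lambda>x. dderiv v X x $ i)"
  by (rule dderiv_bounded_linear_compose[OF bounded_linear_vec_nth assms])

lemma degree_below_vec:
  fixes X :: "('n::finite) vec_field"
  shows "X \<in> poly_vec_fields \<Longrightarrow> (\<And>i. degree_below d (\<lambda>x. X x $ i)) \<Longrightarrow> degree_below d X"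
proof (induction d arbitrary: X)
  case 0
  then show ?case by (auto simp: vec_eq_iff fun_eq_iff)
next
  case (Suc d)
  then show ?case
    using dderiv_vec_nth[OF vec_field_differentiable[OF Suc.prems(1)]]
    by (auto simp: vec_field_dderiv)
qed

text \<open>Derivatives lower the degree, and the finitely many components have a common bound, so
  passing to derivatives is well-founded. The degree itself stays hidden.\<close>

lemma poly_vec_field_induct [consumes 1, case_names zero dderiv]:
  fixes X :: "('n::finite) vec_field"
  assumes "X \<in> poly_vec_fields"
    and zero: "P (\<lambda>x. 0)"
    and step: "\<And>X. X \<in> poly_vec_fields \<Longrightarrow> (\<And>v. P (dderiv v X)) \<Longrightarrow> P X"
  shows "P X"
proof -
  have "\<forall>i. \<exists>d. degree_below d (\<lambda>x. X x $ i)"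
    using assms(1) real_polynomial_function_degree_below by (auto simp: poly_vec_fields_def)
  then obtain d where d: "\<And>i. degree_below (d i) (\<lambda>x. X x $ i)" by metis
  have "degree_below (d i) (\<lambda>x. X x $ i) \<Longrightarrow> degree_below (Max (range d)) (\<lambda>x. X x $ i)" for i
    by (erule degree_below_mono) simp
  then have "degree_below (Max (range d)) X"
    using degree_below_vec[OF assms(1)] d by blast
  moreover have "X \<in> poly_vec_fields \<Longrightarrow> degree_below k X \<Longrightarrow> P X" for k X
    by (induction k arbitrary: X) (auto intro: zero step vec_field_dderiv)
  ultimately show ?thesis using assms(1) by blast
qed

lemma vf_bracket_dderiv: "vf_bracket X Y = (\<lambda>x. dderiv (X x) Y x - dderiv (Y x) X x)"
  by (simp add: vf_bracket_def dderiv_def)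

lemma vf_bracket_const: "vf_bracket (\<lambda>x. v) X = dderiv v X"
  by (simp add: vf_bracket_def dderiv_def frechet_derivative_const)

lemma linear_vec_axis:
  fixes f :: "real^'n::finite \<Rightarrow> 'b::real_vector"
  assumes "linear f"
  shows "f x = (\<Sum>i\<in>UNIV. x $ i *\<^sub>R f (axis i 1))"
proof -
  have "f x = f (\<Sum>i\<in>UNIV. x $ i *\<^sub>R axis i 1)" by (simp add: basis_expansion scalar_mult_eq_scaleR[symmetric])
  then show ?thesis using assms by (simp add: linear_sum linear_scale)
qed

section \<open>The conformal algebra\<close>

lemma metric_commute: "metric a u v = metric a v u"
  by (simp add: metric_def mult_ac)

lemma metric_add: "metric a (u + v) w = metric a u w + metric a v w"
  "metric a w (u + v) = metric a w u + metric a w v"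
  by (simp_all add: metric_def algebra_simps sum.distrib)

lemma metric_diff: "metric a (u - v) w = metric a u w - metric a v w"
  "metric a w (u - v) = metric a w u - metric a w v"
  by (simp_all add: metric_def algebra_simps sum_subtractf)

lemma metric_scaleR: "metric a (c *\<^sub>R u) w = c * metric a u w"
  "metric a w (c *\<^sub>R u) = c * metric a w u"
  by (simp_all add: metric_def sum_distrib_left mult_ac)

lemma metric_zero: "metric a 0 w = 0" "metric a w 0 = 0"
  by (simp_all add: metric_def)

lemma metric_axis: "metric a v (axis i 1) = a i * v $ i" "metric a (axis i 1) v = a i * v $ i"
  by (simp_all add: metric_def axis_def if_distrib [of "\<lambda>x. _ * x"] if_distrib [of "\<lambda>x. x * _"] cong: if_cong)

lemma axis_component: "axis k (1::real) $ m = (if m = k then 1 else 0)"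
  by (simp add: axis_def)

lemmas metric_simps = metric_add metric_diff metric_scaleR metric_zero

lemma quadratic_vf_metric:
  "quadratic_vf a \<alpha> x = \<alpha> x *\<^sub>R x - (metric a x x / 2) *\<^sub>R sharp a \<alpha>"
  by (simp add: quadratic_vf_def metric_def power2_eq_square mult_ac)

lemma has_derivative_metric_self:
  "((\<lambda>x. metric a x x) has_derivative (\<lambda>v. 2 * metric a x v)) (at x)"
  unfolding metric_def
  by (auto intro!: derivative_eq_intros bounded_linear.has_derivative[OF bounded_linear_vec_nth]
      simp: sum_distrib_left algebra_simps fun_eq_iff)

lemma has_derivative_quadratic_vf:
  assumes "linear \<alpha>"
  shows "(quadratic_vf a \<alpha> has_derivative
    (\<lambda>v. \<alpha> v *\<^sub>R x + \<alpha> x *\<^sub>R v - metric a x v *\<^sub>R sharp a \<alpha>)) (at x)"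
proof -
  have "(\<alpha> has_derivative \<alpha>) (at x)"
    using assms linear_conv_bounded_linear bounded_linear_imp_has_derivative by blast
  then show ?thesis
    unfolding quadratic_vf_metric[abs_def]
    by (auto intro!: derivative_eq_intros has_derivative_metric_self simp: algebra_simps)
qed

lemma poly_vec_fields_add:
  "X \<in> poly_vec_fields \<Longrightarrow> Y \<in> poly_vec_fields \<Longrightarrow> (\<lambda>x. X x + Y x) \<in> poly_vec_fields"
  by (auto simp: poly_vec_fields_iff)

lemma poly_vec_fields_diff:
  "X \<in> poly_vec_fields \<Longrightarrow> Y \<in> poly_vec_fields \<Longrightarrow> (\<lambda>x. X x - Y x) \<in> poly_vec_fields"
  by (auto simp: poly_vec_fields_iff)

lemma poly_vec_fields_const: "(\<lambda>x. h) \<in> poly_vec_fields"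
  by (simp add: poly_vec_fields_iff)

lemma poly_vec_fields_matrix: "(\<lambda>x. A *v x) \<in> poly_vec_fields"
  by (simp add: poly_vec_fields_iff polynomial_function_bounded_linear)

lemma poly_vec_fields_quadratic:
  fixes \<alpha> :: "real^'n::finite \<Rightarrow> real"
  assumes "linear \<alpha>"
  shows "quadratic_vf a \<alpha> \<in> poly_vec_fields"
proof -
  have \<alpha>: "real_polynomial_function \<alpha>"
    using assms by (simp add: linear_conv_bounded_linear real_polynomial_function.intros(1))
  have "real_polynomial_function
      (\<lambda>x. \<alpha> x * x $ i - 1/2 * (\<Sum>i\<in>UNIV. a i * (x $ i)\<^sup>2) * sharp a \<alpha> $ i)" for i
    by (intro real_polynomial_function_diff real_polynomial_function.intros(2-4)
        real_polynomial_function_sum real_polynomial_function_power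
        real_polynomial_function_coordinate \<alpha> finite)
  then show ?thesis
    by (simp add: poly_vec_fields_def quadratic_vf_def)
qed

text \<open>The minus signs of \<open>const_vf\<close> and \<open>linear_vf\<close> are dropped;
  both parameter spaces are closed under negation, so the family is the same.\<close>

definition conformal_field ::
    "('n::finite \<Rightarrow> real) \<Rightarrow> real^'n \<Rightarrow> real^'n^'n \<Rightarrow> (real^'n \<Rightarrow> real) \<Rightarrow> 'n vec_field" where
  "conformal_field a h A \<alpha> = (\<lambda>x. h + A *v x + quadratic_vf a \<alpha> x)"

text \<open>The factor \<open>c\<close> is twice the coefficient of \<open>mat 1\<close>. This form
  carries no decomposition along, so sums and commutators can be treated directly.\<close>

lemma co_matrices_iff:
  "A \<in> co_matrices a \<longleftrightarrow>
    (\<exists>c. \<forall>u v. metric a (A *v u) v + metric a u (A *v v) = c * metric a u v)"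
proof
  assume "A \<in> co_matrices a"
  then obtain B c where "A = B + c *\<^sub>R mat 1"
    "\<And>u v. metric a (B *v u) v + metric a u (B *v v) = 0"
    unfolding co_matrices_def so_matrices_def by blast
  then have "metric a (A *v u) v + metric a u (A *v v) = 2 * c * metric a u v" for u v
    by (simp add: matrix_vector_mult_add_rdistrib scaleR_matrix_vector_assoc[symmetric] metric_simps)
  then show "\<exists>c. \<forall>u v. metric a (A *v u) v + metric a u (A *v v) = c * metric a u v" by blast
next
  assume "\<exists>c. \<forall>u v. metric a (A *v u) v + metric a u (A *v v) = c * metric a u v"
  then obtain c where c: "\<And>u v. metric a (A *v u) v + metric a u (A *v v) = c * metric a u v"
    by blast
  have "A - (c/2) *\<^sub>R mat 1 \<in> so_matrices a"
    using c by (simp add: so_matrices_def matrix_vector_mult_diff_rdistrib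
        scaleR_matrix_vector_assoc[symmetric] metric_simps)
  then show "A \<in> co_matrices a"
    unfolding co_matrices_def by (auto intro!: exI[of _ "A - (c/2) *\<^sub>R mat 1"] exI[of _ "c/2"])
qed

lemma co_matrices_entry_iff:
  fixes A :: "real^'n::finite^'n"
  shows
  "A \<in> co_matrices a \<longleftrightarrow>
    (\<exists>c. \<forall>i j. a i * A $ i $ j + a j * A $ j $ i = (if i = j then c * a i else 0))"
proof -
  have "(\<forall>u v. metric a (A *v u) v + metric a u (A *v v) = c * metric a u v) \<longleftrightarrow>
    (\<forall>i j. a i * A $ i $ j + a j * A $ j $ i = (if i = j then c * a i else 0))" (is "?L \<longleftrightarrow> ?R") for c
  proof
    assume L: ?L
    show ?R
    proof (intro allI)
      fix i j
      show "a i * A $ i $ j + a j * A $ j $ i = (if i = j then c * a i else 0)"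
        using L[rule_format, of "axis j 1" "axis i 1"]
        by (simp add: metric_axis matrix_vector_mult_basis column_def)
          (auto simp: axis_def split: if_splits)
    qed
  next
    assume R: ?R
    show ?L
    proof (intro allI)
      fix u v :: "real^'n"
      have "metric a (A *v u) v = (\<Sum>i\<in>UNIV. \<Sum>j\<in>UNIV. a i * A $ i $ j * (u $ j * v $ i))"
        by (simp add: metric_def matrix_vector_mult_def sum_distrib_left sum_distrib_right mult_ac)
      moreover have "metric a u (A *v v) = (\<Sum>j\<in>UNIV. \<Sum>i\<in>UNIV. a j * A $ j $ i * (u $ j * v $ i))"
        by (simp add: metric_def matrix_vector_mult_def sum_distrib_left sum_distrib_right mult_ac)
      ultimately have "metric a (A *v u) v + metric a u (A *v v)
        = (\<Sum>i\<in>UNIV. \<Sum>j\<in>UNIV. (a i * A $ i $ j + a j * A $ j $ i) * (u $ j * v $ i))"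
        by (subst (asm) (2) sum.swap) (simp add: sum.distrib distrib_right)
      also have "\<dots> = (\<Sum>i\<in>UNIV. \<Sum>j\<in>UNIV. if i = j then c * a i * (u $ j * v $ i) else 0)"
        using R by (intro sum.cong refl) auto
      also have "\<dots> = c * metric a u v"
        by (simp add: metric_def sum_distrib_left mult_ac)
      finally show "metric a (A *v u) v + metric a u (A *v v) = c * metric a u v" .
    qed
  qed
  then show ?thesis by (simp add: co_matrices_iff)
qed

lemma co_matrices_add: "A \<in> co_matrices a \<Longrightarrow> B \<in> co_matrices a \<Longrightarrow> A + B \<in> co_matrices a"
proof (unfold co_matrices_iff, elim exE)
  fix c d
  assume "\<forall>u v. metric a (A *v u) v + metric a u (A *v v) = c * metric a u v"
    "\<forall>u v. metric a (B *v u) v + metric a u (B *v v) = d * metric a u v"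
  then show "\<exists>c. \<forall>u v. metric a ((A + B) *v u) v + metric a u ((A + B) *v v) = c * metric a u v"
    by (intro exI[of _ "c + d"])
      (simp add: matrix_vector_mult_add_rdistrib metric_simps, simp add: algebra_simps)
qed

lemma co_matrices_scaleR: "A \<in> co_matrices a \<Longrightarrow> r *\<^sub>R A \<in> co_matrices a"
proof (unfold co_matrices_iff, elim exE)
  fix c
  assume "\<forall>u v. metric a (A *v u) v + metric a u (A *v v) = c * metric a u v"
  then show "\<exists>c. \<forall>u v. metric a ((r *\<^sub>R A) *v u) v + metric a u ((r *\<^sub>R A) *v v) = c * metric a u v"
    by (intro exI[of _ "r * c"])
      (simp add: scaleR_matrix_vector_assoc[symmetric] metric_simps distrib_left[symmetric] mult.assoc)
qed

lemma co_matrices_minus: "A \<in> co_matrices a \<Longrightarrow> - A \<in> co_matrices a"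
  using co_matrices_scaleR[of A a "-1"] by simp

lemma co_matrices_diff: "A \<in> co_matrices a \<Longrightarrow> B \<in> co_matrices a \<Longrightarrow> A - B \<in> co_matrices a"
  using co_matrices_add[OF _ co_matrices_minus] by force

lemma co_matrices_mat: "mat 1 \<in> co_matrices a"
  unfolding co_matrices_iff by (intro exI[of _ 2]) simp

lemma co_matrices_zero: "0 \<in> co_matrices a"
  using co_matrices_scaleR[OF co_matrices_mat, of 0] by simp

text \<open>Moving \<open>A\<close> and \<open>B\<close> across the form costs terms in
  \<open>c\<close> and \<open>d\<close>; they cancel in the commutator, which is even skew.\<close>

lemma co_matrices_commutator:
  assumes "A \<in> co_matrices a" "B \<in> co_matrices a"
  shows "A ** B - B ** A \<in> co_matrices a"
proof -
  obtain c d where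
    c: "\<And>u v. metric a (A *v u) v = c * metric a u v - metric a u (A *v v)" and
    d: "\<And>u v. metric a (B *v u) v = d * metric a u v - metric a u (B *v v)"
    using assms unfolding co_matrices_iff by (metis add_diff_cancel_right')
  have "metric a ((A ** B - B ** A) *v u) v + metric a u ((A ** B - B ** A) *v v) = 0" for u v
    by (simp add: matrix_vector_mult_diff_rdistrib matrix_vector_mul_assoc[symmetric]
        metric_simps c d algebra_simps)
  then show ?thesis unfolding co_matrices_iff by (intro exI[of _ 0]) simp
qed

lemma conformal_algebra_eq:
  "conformal_algebra a = {conformal_field a h A \<alpha> | h A \<alpha>. A \<in> co_matrices a \<and> linear \<alpha>}"
proof (intro equalityI subsetI)
  fix X assume "X \<in> conformal_algebra a"
  then obtain h A \<alpha> where *: "X = (\<lambda>x. const_vf h x + linear_vf A x + quadratic_vf a \<alpha> x)"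
    "A \<in> co_matrices a" "linear \<alpha>" unfolding conformal_algebra_def by blast
  then have "X = conformal_field a (- h) (- A) \<alpha>"
    by (auto simp: conformal_field_def const_vf_def linear_vf_def matrix_vector_mult_def vec_eq_iff
        sum_negf)
  then show "X \<in> {conformal_field a h A \<alpha> | h A \<alpha>. A \<in> co_matrices a \<and> linear \<alpha>}"
    using * co_matrices_minus by blast
next
  fix X assume "X \<in> {conformal_field a h A \<alpha> | h A \<alpha>. A \<in> co_matrices a \<and> linear \<alpha>}"
  then obtain h A \<alpha> where *: "X = conformal_field a h A \<alpha>" "A \<in> co_matrices a" "linear \<alpha>" by blast
  then have "X = (\<lambda>x. const_vf (- h) x + linear_vf (- A) x + quadratic_vf a \<alpha> x)"
    by (auto simp: conformal_field_def const_vf_def linear_vf_def matrix_vector_mult_def vec_eq_iff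
        sum_negf)
  then show "X \<in> conformal_algebra a"
    using * co_matrices_minus unfolding conformal_algebra_def by blast
qed

lemma conformal_field_in_poly: "linear \<alpha> \<Longrightarrow> conformal_field a h A \<alpha> \<in> poly_vec_fields"
  unfolding conformal_field_def
  by (intro poly_vec_fields_add poly_vec_fields_const poly_vec_fields_matrix poly_vec_fields_quadratic)

lemma dderiv_matrix: "dderiv v (\<lambda>x. A *v x) = (\<lambda>x. A *v v)"
  for A :: "real^'n^'m"
  by (intro dderiv_bounded_linear) simp

lemma dderiv_quadratic_vf:
  assumes "linear \<alpha>"
  shows "dderiv v (quadratic_vf a \<alpha>) = (\<lambda>x. \<alpha> v *\<^sub>R x + \<alpha> x *\<^sub>R v - metric a x v *\<^sub>R sharp a \<alpha>)"
  by (intro dderiv_eq has_derivative_quadratic_vf assms)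

lemma dderiv_conformal_field:
  assumes "linear \<alpha>"
  shows "dderiv v (conformal_field a h A \<alpha>) = (\<lambda>x. A *v v + dderiv v (quadratic_vf a \<alpha>) x)"
proof -
  have "(conformal_field a h A \<alpha> has_derivative
     (\<lambda>v. A *v v + (\<alpha> v *\<^sub>R x + \<alpha> x *\<^sub>R v - metric a x v *\<^sub>R sharp a \<alpha>))) (at x)" for x
    unfolding conformal_field_def
    by (auto intro!: derivative_eq_intros has_derivative_quadratic_vf assms
        bounded_linear_imp_has_derivative)
  from dderiv_eq[OF this] show ?thesis by (simp add: dderiv_quadratic_vf assms)
qed

lemma sharp_add: "sharp a (\<lambda>x. \<alpha> x + \<beta> x) = sharp a \<alpha> + sharp a \<beta>"
  by (simp add: sharp_def vec_eq_iff algebra_simps)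

lemma sharp_diff: "sharp a (\<lambda>x. \<alpha> x - \<beta> x) = sharp a \<alpha> - sharp a \<beta>"
  by (simp add: sharp_def vec_eq_iff algebra_simps)

lemma sharp_scale: "sharp a (\<lambda>x. c * \<alpha> x) = c *\<^sub>R sharp a \<alpha>"
  by (simp add: sharp_def vec_eq_iff)

text \<open>All signatures are treated at once, and the numbering of the coordinates
  disappears.\<close>

locale orthonormal_signature =
  fixes a :: "'n::finite \<Rightarrow> real"
  assumes square_one: "a i * a i = 1"
begin

lemma coeff_nonzero: "a i \<noteq> 0"
  using square_one[of i] by auto

lemma metric_sharp:
  assumes "linear \<alpha>"
  shows "metric a (sharp a \<alpha>) v = \<alpha> v" "metric a v (sharp a \<alpha>) = \<alpha> v"
proof -
  have "a i * sharp a \<alpha> $ i = \<alpha> (axis i 1)" for i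
    by (simp add: sharp_def mult.assoc[symmetric] square_one)
  then show "metric a (sharp a \<alpha>) v = \<alpha> v"
    by (simp add: metric_def linear_vec_axis[OF assms, of v] mult.commute)
  then show "metric a v (sharp a \<alpha>) = \<alpha> v" by (simp add: metric_commute)
qed

lemma metric_nondegenerate:
  assumes "\<And>v. metric a u v = metric a w v"
  shows "u = w"
  using assms[of "axis _ 1"] coeff_nonzero by (simp add: metric_axis vec_eq_iff)

text \<open>Conformality enters twice: it makes
  \<open>c *\<^sub>R sharp a \<alpha> - A *v sharp a \<alpha>\<close> the dual vector of the
  pulled-back covector, and it turns \<open>metric a x (A *v x)\<close> into \<open>c\<close> times
  half of \<open>metric a x x\<close>. The left side is the bracket of a linear with a quadratic
  field.\<close>

lemma dderiv_quadratic_vf_co: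
  assumes "A \<in> co_matrices a" "linear \<alpha>"
  shows "dderiv (A *v x) (quadratic_vf a \<alpha>) x - A *v quadratic_vf a \<alpha> x
    = quadratic_vf a (\<lambda>y. \<alpha> (A *v y)) x"
proof -
  obtain c where c: "\<And>u v. metric a (A *v u) v + metric a u (A *v v) = c * metric a u v"
    using assms(1) unfolding co_matrices_iff by blast
  have lin: "linear (\<lambda>y. \<alpha> (A *v y))"
    using linear_compose[OF _ assms(2), of "(*v) A"] by (simp add: o_def)
  have sharp: "sharp a (\<lambda>y. \<alpha> (A *v y)) = c *\<^sub>R sharp a \<alpha> - A *v sharp a \<alpha>"
  proof (rule metric_nondegenerate)
    fix v
    show "metric a (sharp a (\<lambda>y. \<alpha> (A *v y))) v = metric a (c *\<^sub>R sharp a \<alpha> - A *v sharp a \<alpha>) v"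
      using c[of "sharp a \<alpha>" v] by (simp add: metric_simps metric_sharp lin assms)
  qed
  have "2 * metric a x (A *v x) = c * metric a x x"
    using c[of x x] metric_commute[of a x "A *v x"] by simp
  then have "metric a x (A *v x) = c * (metric a x x / 2)" by simp
  then show ?thesis
    by (simp add: dderiv_quadratic_vf assms quadratic_vf_metric sharp matrix_vector_mult_diff_distrib
        matrix_vector_mult_scaleR algebra_simps)
qed

text \<open>The symmetry of \<open>\<beta> (sharp a \<alpha>)\<close> in the two covectors makes
  quadratic fields commute, so no cubic terms arise.\<close>

lemma quadratic_vf_commute:
  assumes "linear \<alpha>" "linear \<beta>"
  shows "dderiv (quadratic_vf a \<alpha> x) (quadratic_vf a \<beta>) x
    = dderiv (quadratic_vf a \<beta> x) (quadratic_vf a \<alpha>) x"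
proof -
  have "\<beta> (sharp a \<alpha>) = \<alpha> (sharp a \<beta>)"
    using metric_sharp[OF assms(1), of "sharp a \<beta>"] metric_sharp[OF assms(2), of "sharp a \<alpha>"] by simp
  then show ?thesis
    by (simp add: dderiv_quadratic_vf assms quadratic_vf_metric linear_diff linear_scale
        metric_simps metric_sharp) (simp add: vec_eq_iff algebra_simps)
qed

text \<open>The derivative is the homothety \<open>\<alpha> h *\<^sub>R x\<close>, responsible for
  the factor \<open>2 * \<alpha> h\<close>, plus \<open>\<alpha> x *\<^sub>R h - metric a x h
  *\<^sub>R sharp a \<alpha>\<close>, which is skew.\<close>

lemma mixed_bracket_co:
  assumes "linear \<alpha>"
  shows "\<exists>C\<in>co_matrices a. \<forall>x. dderiv h (quadratic_vf a \<alpha>) x = C *v x"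
proof
  let ?f = "\<lambda>x. \<alpha> h *\<^sub>R x + \<alpha> x *\<^sub>R h - metric a x h *\<^sub>R sharp a \<alpha>"
  have "linear ?f"
    by (intro linearI)
      (simp_all add: linear_add linear_scale assms metric_simps algebra_simps)
  then have *: "matrix ?f *v x = ?f x" for x by (simp add: matrix_works linear_matrix_vector_mul_eq)
  show "matrix ?f \<in> co_matrices a"
    unfolding co_matrices_iff *
    by (intro exI[of _ "2 * \<alpha> h"])
      (simp add: metric_simps metric_sharp assms metric_commute[of a _ h] algebra_simps)
  show "\<forall>x. dderiv h (quadratic_vf a \<alpha>) x = matrix ?f *v x"
    by (simp add: * dderiv_quadratic_vf assms)
qed

lemma lie_subalgebra_conformal_algebra: "lie_subalgebra (conformal_algebra a)"
  unfolding lie_subalgebra_def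
proof (intro conjI ballI allI)
  show "conformal_algebra a \<subseteq> poly_vec_fields"
    by (auto simp: conformal_algebra_eq conformal_field_in_poly)
  have "(\<lambda>x. 0) = conformal_field a 0 0 (\<lambda>x. 0)"
    by (auto simp: conformal_field_def quadratic_vf_def sharp_def vec_eq_iff)
  then show "(\<lambda>x. 0) \<in> conformal_algebra a"
    unfolding conformal_algebra_eq using co_matrices_zero linear_zero by blast
next
  fix X Y assume "X \<in> conformal_algebra a" "Y \<in> conformal_algebra a"
  then obtain h A \<alpha> k B \<beta> where
    X: "X = conformal_field a h A \<alpha>" "A \<in> co_matrices a" "linear \<alpha>" and
    Y: "Y = conformal_field a k B \<beta>" "B \<in> co_matrices a" "linear \<beta>"
    unfolding conformal_algebra_eq by blast
  have "(\<lambda>x. X x + Y x) = conformal_field a (h + k) (A + B) (\<lambda>x. \<alpha> x + \<beta> x)"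
    by (simp add: X Y conformal_field_def quadratic_vf_metric sharp_add
        matrix_vector_mult_add_rdistrib algebra_simps)
  then show "(\<lambda>x. X x + Y x) \<in> conformal_algebra a"
    unfolding conformal_algebra_eq using X Y co_matrices_add linear_compose_add by blast
  obtain C where C: "C \<in> co_matrices a" "\<And>x. dderiv h (quadratic_vf a \<beta>) x = C *v x"
    using mixed_bracket_co Y by blast
  obtain D where D: "D \<in> co_matrices a" "\<And>x. dderiv k (quadratic_vf a \<alpha>) x = D *v x"
    using mixed_bracket_co X by blast
  let ?\<gamma> = "\<lambda>x. \<beta> (A *v x) - \<alpha> (B *v x)"
  have lin: "linear (\<lambda>x. \<beta> (A *v x))" "linear (\<lambda>x. \<alpha> (B *v x))"
    using linear_compose[OF _ Y(3), of "(*v) A"] linear_compose[OF _ X(3), of "(*v) B"]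
    by (simp_all add: o_def)
  have split: "dderiv (u + v + w) (quadratic_vf a \<delta>) x = dderiv u (quadratic_vf a \<delta>) x
      + dderiv v (quadratic_vf a \<delta>) x + dderiv w (quadratic_vf a \<delta>) x"
    if "linear \<delta>" for u v w x \<delta>
    by (simp add: dderiv_quadratic_vf that metric_simps linear_add algebra_simps)
  \<comment> \<open>Sorted by degree: \<open>C\<close> and \<open>D\<close> come from constant with
    quadratic, \<open>?\<gamma>\<close> from linear with quadratic, and the cubic terms cancel. The
    bracket of linear fields is the reversed matrix commutator.\<close>
  have "vf_bracket X Y x = conformal_field a (B *v h - A *v k) (B ** A - A ** B + C - D) ?\<gamma> x" for x
  proof -
    have "vf_bracket X Y x =
      B *v (h + A *v x + quadratic_vf a \<alpha> x) + (dderiv h (quadratic_vf a \<beta>) x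
       + dderiv (A *v x) (quadratic_vf a \<beta>) x + dderiv (quadratic_vf a \<alpha> x) (quadratic_vf a \<beta>) x)
      - (A *v (k + B *v x + quadratic_vf a \<beta> x) + (dderiv k (quadratic_vf a \<alpha>) x
       + dderiv (B *v x) (quadratic_vf a \<alpha>) x + dderiv (quadratic_vf a \<beta> x) (quadratic_vf a \<alpha>) x))"
      unfolding vf_bracket_dderiv X(1) Y(1)
      by (simp add: dderiv_conformal_field X(3) Y(3)) (simp add: conformal_field_def split X(3) Y(3))
    also have "\<dots> = (B *v h - A *v k) + (B *v (A *v x) - A *v (B *v x) + C *v x - D *v x)
      + ((dderiv (A *v x) (quadratic_vf a \<beta>) x - A *v quadratic_vf a \<beta> x)
         - (dderiv (B *v x) (quadratic_vf a \<alpha>) x - B *v quadratic_vf a \<alpha> x))"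
      by (simp add: C D quadratic_vf_commute[OF X(3) Y(3)] matrix_vector_right_distrib algebra_simps)
    also have "\<dots> = (B *v h - A *v k) + (B *v (A *v x) - A *v (B *v x) + C *v x - D *v x)
      + (quadratic_vf a (\<lambda>y. \<beta> (A *v y)) x - quadratic_vf a (\<lambda>y. \<alpha> (B *v y)) x)"
      using dderiv_quadratic_vf_co X Y by simp
    also have "\<dots> = conformal_field a (B *v h - A *v k) (B ** A - A ** B + C - D) ?\<gamma> x"
      by (simp add: conformal_field_def quadratic_vf_metric sharp_diff matrix_vector_mul_assoc
          matrix_vector_mult_add_rdistrib matrix_vector_mult_diff_rdistrib algebra_simps)
    finally show ?thesis .
  qed
  then have "vf_bracket X Y = conformal_field a (B *v h - A *v k) (B ** A - A ** B + C - D) ?\<gamma>"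
    by blast
  moreover have "B ** A - A ** B + C - D \<in> co_matrices a"
    using C D X Y by (intro co_matrices_diff co_matrices_add co_matrices_commutator)
  moreover have "linear ?\<gamma>" using lin by (rule linear_compose_sub)
  ultimately show "vf_bracket X Y \<in> conformal_algebra a"
    unfolding conformal_algebra_eq by blast
next
  fix c :: real and X assume "X \<in> conformal_algebra a"
  then obtain h A \<alpha> where
    X: "X = conformal_field a h A \<alpha>" "A \<in> co_matrices a" "linear \<alpha>"
    unfolding conformal_algebra_eq by blast
  have "(\<lambda>x. c *\<^sub>R X x) = conformal_field a (c *\<^sub>R h) (c *\<^sub>R A) (\<lambda>x. c * \<alpha> x)"
    by (simp add: X conformal_field_def quadratic_vf_metric sharp_scale
        scaleR_matrix_vector_assoc[symmetric] algebra_simps)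
  moreover have "linear (\<lambda>x. c * \<alpha> x)"
    using linear_compose_scale_right[OF X(3), of c] by simp
  ultimately show "(\<lambda>x. c *\<^sub>R X x) \<in> conformal_algebra a"
    unfolding conformal_algebra_eq using X co_matrices_scaleR by blast
qed

end

section \<open>Prolongations of the conformal matrices\<close>

lemma obtain_third_index:
  fixes i j :: "'n::finite"
  assumes "CARD('n) > 2"
  obtains k where "k \<noteq> i" "k \<noteq> j"
proof -
  have "card {i, j} < CARD('n)" using assms by (cases "i = j") auto
  then have "UNIV - {i, j} \<noteq> {}" by (metis Diff_eq_empty_iff card_mono finite leD)
  then show thesis using that by blast
qed

lemma vec_field_eq_if_dderiv_eq:
  fixes X Y :: "('n::finite) vec_field"
  assumes "X \<in> poly_vec_fields" "Y \<in> poly_vec_fields"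
    and "\<And>i x. dderiv (axis i 1) X x = dderiv (axis i 1) Y x"
  obtains c where "X = (\<lambda>x. c + Y x)"
proof -
  let ?Z = "\<lambda>x. X x - Y x"
  have Z: "?Z \<in> poly_vec_fields" using assms poly_vec_fields_diff by blast
  have "dderiv (axis i 1) ?Z x = 0" for i x
    using assms by (simp add: dderiv_diff vec_field_differentiable)
  then have "dderiv v ?Z x = 0" for v x
    using linear_vec_axis[OF linear_dderiv[OF vec_field_differentiable[OF Z, of x]], of v] by simp
  then have "(?Z has_derivative (\<lambda>h. 0)) (at x)" for x
    using has_derivative_dderiv[OF vec_field_differentiable[OF Z], of x] by simp
  then obtain c where "\<And>x. X x - Y x = c"
    using has_derivative_zero_constant[of UNIV ?Z] by auto
  then show thesis using that[of c] by (auto simp: algebra_simps fun_eq_iff)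
qed

context orthonormal_signature
begin

text \<open>The second prolongation of the conformal matrices vanishes; in dimension two it does not.\<close>

lemma second_prolongation_zero:
  fixes \<alpha> :: "'n \<Rightarrow> real^'n \<Rightarrow> real"
  assumes card: "CARD('n) > 2"
    and lin: "\<And>i. linear (\<alpha> i)"
    and sym: "\<And>i k x. \<alpha> i (axis k 1) *\<^sub>R x + \<alpha> i x *\<^sub>R axis k 1 - metric a x (axis k 1) *\<^sub>R sharp a (\<alpha> i)
      = \<alpha> k (axis i 1) *\<^sub>R x + \<alpha> k x *\<^sub>R axis i 1 - metric a x (axis i 1) *\<^sub>R sharp a (\<alpha> k)"
  shows "\<alpha> i x = 0"
proof -
  define b where "b i j = \<alpha> i (axis j 1)" for i j
  have sym': "b i k * (if m = l then 1 else 0) + b i l * (if m = k then 1 else 0)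
      - a k * (if k = l then 1 else 0) * (a m * b i m)
    = b k i * (if m = l then 1 else 0) + b k l * (if m = i then 1 else 0)
      - a i * (if i = l then 1 else 0) * (a m * b k m)" for i k l m
    using arg_cong[OF sym[of i k "axis l 1"], of "\<lambda>v. v $ m"]
    by (simp only: metric_axis(1) b_def sharp_def axis_component vector_minus_component vector_add_component
        vector_scaleR_component vec_lambda_beta real_scaleR_def)
  \<comment> \<open>With a third index \<open>k\<close> used twice, every term of
    \<open>sym'\<close> vanishes except \<open>a k * (a l * b i l)\<close>.\<close>
  have off: "b i l = 0" if "l \<noteq> i" for i l
  proof -
    obtain k where "k \<noteq> i" "k \<noteq> l" by (rule obtain_third_index[OF card])
    then show ?thesis using sym'[of i k k l] that by auto
  qed
  have diag: "a k * b k k = - (a i * b i i)" if "k \<noteq> i" for i k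
  proof -
    have "b k k = - (a k * (a i * b i i))" using sym'[of i k i k] that by auto
    then have "a k * b k k = a k * - (a k * (a i * b i i))" by simp
    then show ?thesis by (simp add: mult.assoc[symmetric] square_one)
  qed
  \<comment> \<open>The numbers \<open>a i * b i i\<close> are pairwise opposite. Three such numbers
    are zero; two need not be.\<close>
  have "b i i = 0" for i
  proof -
    obtain k where k: "k \<noteq> i" "k \<noteq> i" by (rule obtain_third_index[OF card])
    obtain m where m: "m \<noteq> i" "m \<noteq> k" by (rule obtain_third_index[OF card])
    have "a i * b i i = 0" using diag[of k i] diag[of m i] diag[of m k] k m by simp
    then show ?thesis using coeff_nonzero by simp
  qed
  then have "b i l = 0" for l using off by metis
  then show ?thesis using linear_vec_axis[OF lin, of i x] by (simp add: b_def)
qed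

text \<open>The scheme of the Koszul formula: \<open>a m * A i $ m $ k\<close> is symmetric in
  \<open>i\<close>, \<open>k\<close> and skew in \<open>m\<close>, \<open>k\<close> up to the
  factors \<open>c\<close>, so combining three permuted relations solves for it.\<close>

lemma first_prolongation:
  fixes A :: "'n \<Rightarrow> real^'n^'n"
  assumes co: "\<And>i. A i \<in> co_matrices a"
    and sym: "\<And>i k. A i *v axis k 1 = A k *v axis i 1"
  obtains \<beta> where "linear \<beta>"
    "\<And>i x. A i *v x = dderiv (axis i 1) (quadratic_vf a \<beta>) x"
proof -
  obtain c where c: "\<And>k i j. a i * A k $ i $ j + a j * A k $ j $ i = (if i = j then c k * a i else 0)"
    using co unfolding co_matrices_entry_iff by metis
  have s: "A i $ m $ k = A k $ m $ i" for i k m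
    using arg_cong[OF sym[of i k], of "\<lambda>v. v $ m"] by (simp add: matrix_vector_mult_basis column_def)
  \<comment> \<open>As in \<open>mixed_bracket_co\<close>, the derivative of
    \<open>quadratic_vf a \<beta>\<close> along \<open>axis i 1\<close> has conformal factor
    \<open>2 * \<beta> (axis i 1)\<close>, which must equal \<open>c i\<close>.\<close>
  define \<beta> :: "real^'n \<Rightarrow> real" where "\<beta> x = (\<Sum>i\<in>UNIV. c i / 2 * x $ i)" for x
  have lin: "linear \<beta>"
    by (rule linearI) (simp_all add: \<beta>_def algebra_simps sum.distrib sum_distrib_left)
  have \<beta>_axis: "\<beta> (axis i 1) = c i / 2" for i
    by (simp add: \<beta>_def axis_def if_distrib[of "\<lambda>x. _ * x"] cong: if_cong)
  have entry: "2 * (a m * A i $ m $ k) = (if m = k then c i * a m else 0)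
      + (if m = i then c k * a m else 0) - (if k = i then c m * a k else 0)" for m i k
    using c[of m i k] c[of m k i] c[of k m i]
    unfolding s[of i k m] s[of k i m] s[of k m i] by linarith
  have "A i *v axis k 1 = dderiv (axis i 1) (quadratic_vf a \<beta>) (axis k 1)" for i k
  proof (rule vec_eq_iff[THEN iffD2], rule)
    fix m
    have sq: "a m * (a m * z) = z" for z by (simp add: mult.assoc[symmetric] square_one)
    have "2 * A i $ m $ k = a m * (2 * (a m * A i $ m $ k))" by (simp add: sq)
    also have "\<dots> = (if m = k then c i else 0) + (if m = i then c k else 0)
        - (if k = i then a k * (a m * c m) else 0)"
      unfolding entry by (simp add: algebra_simps sq square_one)
    finally show "(A i *v axis k 1) $ m = dderiv (axis i 1) (quadratic_vf a \<beta>) (axis k 1) $ m"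
      by (simp add: matrix_vector_mult_basis column_def dderiv_quadratic_vf lin \<beta>_axis metric_axis
          sharp_def) (auto simp: axis_def algebra_simps)
  qed
  moreover have "linear (\<lambda>x. dderiv (axis i 1) (quadratic_vf a \<beta>) x)" for i
    by (rule linearI) (simp_all add: dderiv_quadratic_vf lin metric_simps linear_add linear_scale algebra_simps)
  ultimately have "A i *v x = dderiv (axis i 1) (quadratic_vf a \<beta>) x" for i x
    using linear_vec_axis[of "(*v) (A i)" x] linear_vec_axis[of "dderiv (axis i 1) (quadratic_vf a \<beta>)" x]
    by simp
  then show thesis using that lin by blast
qed

text \<open>Equality of mixed derivatives gives both prolongation conditions, at 0 for the matrices
  \<open>A i\<close> and then for the covectors. The resulting matrix is arbitrary, since
  differentiation only sees it in constant terms, and every constant field is conformal.\<close>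

lemma conformal_field_if_dderiv_conformal:
  fixes X :: "'n vec_field"
  assumes card: "CARD('n) > 2" and X: "X \<in> poly_vec_fields"
    and conf: "\<And>i. dderiv (axis i 1) X \<in> conformal_algebra a"
  obtains h A \<alpha> where "linear \<alpha>" "X = conformal_field a h A \<alpha>"
proof -
  have "\<forall>i. \<exists>h A \<alpha>. dderiv (axis i 1) X = conformal_field a h A \<alpha> \<and> A \<in> co_matrices a \<and> linear \<alpha>"
    using conf unfolding conformal_algebra_eq by blast
  then obtain h A \<alpha> where DX: "\<And>i. dderiv (axis i 1) X = conformal_field a (h i) (A i) (\<alpha> i)"
    and co: "\<And>i. A i \<in> co_matrices a" and lin: "\<And>i. linear (\<alpha> i)"
    by metis
  have "dderiv (axis k 1) (conformal_field a (h i) (A i) (\<alpha> i))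
    = dderiv (axis i 1) (conformal_field a (h k) (A k) (\<alpha> k))" for i k
    using dderiv_commute[of X "axis k 1" "axis i 1"] X by (simp add: DX poly_vec_fields_iff)
  then have comm: "A i *v axis k 1 + dderiv (axis k 1) (quadratic_vf a (\<alpha> i)) x
    = A k *v axis i 1 + dderiv (axis i 1) (quadratic_vf a (\<alpha> k)) x" for i k x
    by (simp add: dderiv_conformal_field lin fun_eq_iff)
  have A: "A i *v axis k 1 = A k *v axis i 1" for i k
    using comm[of i k 0] by (simp add: dderiv_quadratic_vf lin metric_simps linear_0)
  have \<alpha>: "\<alpha> i x = 0" for i x
    using second_prolongation_zero[OF card, of \<alpha> i x] lin comm
    by (simp add: A dderiv_quadratic_vf lin)
  obtain \<beta> where \<beta>: "linear \<beta>" "\<And>i x. A i *v x = dderiv (axis i 1) (quadratic_vf a \<beta>) x"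
    by (rule first_prolongation[OF co A]) blast
  define H where "H = (\<chi> i j. h j $ i)"
  have H: "H *v axis i 1 = h i" for i
    by (simp add: H_def matrix_vector_mult_basis column_def vec_eq_iff)
  have "dderiv (axis i 1) X x = dderiv (axis i 1) (conformal_field a 0 H \<beta>) x" for i x
    unfolding DX dderiv_conformal_field[OF \<beta>(1)] H \<beta>(2)[symmetric]
    by (simp add: conformal_field_def quadratic_vf_metric \<alpha> sharp_def vec_eq_iff)
  then obtain c where "X = (\<lambda>x. c + conformal_field a 0 H \<beta> x)"
    using vec_field_eq_if_dderiv_eq[OF X conformal_field_in_poly[OF \<beta>(1)]] by metis
  then have "X = conformal_field a c H \<beta>" by (auto simp: conformal_field_def)
  then show thesis using that \<beta>(1) by blast
qed

end

section \<open>Maximality of the conformal matrices\<close>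

definition matrix_unit :: "'n \<Rightarrow> 'n \<Rightarrow> real^'n^'n" where
  "matrix_unit i j = (\<chi> r s. if r = i \<and> s = j then 1 else 0)"

lemma matrix_unit_component: "matrix_unit i j $ r $ s = (if r = i \<and> s = j then 1 else 0)"
  by (simp add: matrix_unit_def)

lemma matrix_unit_mult:
  "matrix_unit i j ** matrix_unit k l = (if j = k then matrix_unit i l else 0)"
proof -
  have "(\<Sum>t\<in>UNIV. (if r = i \<and> t = j then 1 else 0) * (if t = k \<and> s = l then 1 else (0::real)))
     = (\<Sum>t\<in>UNIV. if t = j then if r = i \<and> j = k \<and> s = l then 1 else 0 else 0)" for r s
    by (rule sum.cong) auto
  then show ?thesis
    by (simp add: vec_eq_iff matrix_matrix_mult_def matrix_unit_component)
qed

lemma matrix_unit_vector_mult: "matrix_unit i j *v x = x $ j *\<^sub>R axis i 1"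
proof -
  have "(\<Sum>s\<in>UNIV. (if r = i \<and> s = j then 1 else 0) * x $ s)
     = (\<Sum>s\<in>UNIV. if s = j then if r = i then x $ s else 0 else 0)" for r
    by (rule sum.cong) auto
  then show ?thesis
    by (simp add: vec_eq_iff matrix_vector_mult_def matrix_unit_component axis_component)
qed

lemma matrix_unit_expansion:
  "(A::real^'n::finite^'n) = (\<Sum>r\<in>UNIV. \<Sum>s\<in>UNIV. A $ r $ s *\<^sub>R matrix_unit r s)"
proof -
  have "(\<Sum>r\<in>UNIV. \<Sum>s\<in>UNIV. A $ r $ s * (if p = r \<and> q = s then 1 else 0)) = A $ p $ q" for p q
  proof -
    have "(\<Sum>r\<in>UNIV. \<Sum>s\<in>UNIV. A $ r $ s * (if p = r \<and> q = s then 1 else 0))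
      = (\<Sum>r\<in>UNIV. \<Sum>s\<in>UNIV. if s = q then if r = p then A $ r $ s else 0 else 0)"
      by (intro sum.cong) auto
    then show ?thesis by simp
  qed
  then show ?thesis by (simp add: vec_eq_iff matrix_unit_component)
qed

text \<open>The coefficients make it skew for the form. For \<open>i \<noteq> j\<close> it is, up to
  sign, a plane rotation if \<open>a i = a j\<close> and a boost otherwise.\<close>

definition rotation_generator :: "('n \<Rightarrow> real) \<Rightarrow> 'n \<Rightarrow> 'n \<Rightarrow> real^'n^'n" where
  "rotation_generator a i j = a j *\<^sub>R matrix_unit i j - a i *\<^sub>R matrix_unit j i"

lemma rotation_generator_component:
  "rotation_generator a i j $ r $ s
    = (if r = i \<and> s = j then a j else 0) - (if r = j \<and> s = i then a i else 0)"
proof -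
  have "c * (if P then 1 else 0) = (if P then c else (0::real))" for c P by simp
  then show ?thesis
    by (simp only: rotation_generator_def vector_minus_component vector_scaleR_component
        matrix_unit_component real_scaleR_def)
qed

lemma rotation_generator_co: "rotation_generator a i j \<in> co_matrices a"
  unfolding co_matrices_iff
  by (intro exI[of _ 0])
    (simp add: rotation_generator_def matrix_vector_mult_diff_rdistrib
      scaleR_matrix_vector_assoc[symmetric] matrix_unit_vector_mult metric_simps metric_axis)

lemma rotation_generator_mult_component:
  "(rotation_generator a i j ** M) $ r $ s
    = (if r = i then a j * M $ j $ s else 0) - (if r = j then a i * M $ i $ s else 0)"
  "(M ** rotation_generator a i j) $ r $ s
    = (if s = j then a j * M $ r $ i else 0) - (if s = i then a i * M $ r $ j else 0)"
proof -
  have "(\<Sum>t\<in>UNIV. ((if r = i \<and> t = j then a j else 0) - (if r = j \<and> t = i then a i else 0)) * M $ t $ s)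
    = (\<Sum>t\<in>UNIV. (if t = j then if r = i then a j * M $ t $ s else 0 else 0)
        - (if t = i then if r = j then a i * M $ t $ s else 0 else 0))"
    by (intro sum.cong) auto
  then show "(rotation_generator a i j ** M) $ r $ s
    = (if r = i then a j * M $ j $ s else 0) - (if r = j then a i * M $ i $ s else 0)"
    by (simp add: matrix_matrix_mult_def rotation_generator_component sum_subtractf)
  have "(\<Sum>t\<in>UNIV. M $ r $ t * ((if t = i \<and> s = j then a j else 0) - (if t = j \<and> s = i then a i else 0)))
    = (\<Sum>t\<in>UNIV. (if t = i then if s = j then a j * M $ r $ t else 0 else 0)
        - (if t = j then if s = i then a i * M $ r $ t else 0 else 0))"
    by (intro sum.cong) auto
  then show "(M ** rotation_generator a i j) $ r $ s
    = (if s = j then a j * M $ r $ i else 0) - (if s = i then a i * M $ r $ j else 0)"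
    by (simp add: matrix_matrix_mult_def rotation_generator_component sum_subtractf)
qed

context orthonormal_signature
begin

lemma coeff_cases: "a i = 1 \<or> a i = - 1"
  using square_one[of i] by algebra

text \<open>
  With \<open>R\<close> the rotation generator, \<open>(ad R)\<^sup>2\<close> has the eigenvalues \<open>0\<close>, \<open>- a\<^sub>i a\<^sub>j\<close> and \<open>- 4 a\<^sub>i a\<^sub>j\<close>;
  the polynomial in \<open>ad R\<close> below isolates the last eigenspace, spanned by two matrices
  supported in the plane of \<open>i\<close> and \<open>j\<close>.
\<close>

lemma plane_projection_eq:
  fixes M :: "real^'n^'n"
  assumes "i \<noteq> j"
  defines "ad \<equiv> \<lambda>M. rotation_generator a i j ** M - M ** rotation_generator a i j"
  shows "ad (ad (ad (ad M))) + (a i * a j) *\<^sub>R ad (ad M)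
    = 6 *\<^sub>R ((M $ i $ i - M $ j $ j) *\<^sub>R (matrix_unit i i - matrix_unit j j)
       + (M $ i $ j + a i * a j * M $ j $ i) *\<^sub>R (matrix_unit i j + (a i * a j) *\<^sub>R matrix_unit j i))"
proof -
  have ad: "ad M $ r $ s = ((if r = i then a j * M $ j $ s else 0) - (if r = j then a i * M $ i $ s else 0))
     - ((if s = j then a j * M $ r $ i else 0) - (if s = i then a i * M $ r $ j else 0))" for M r s
    by (simp add: ad_def rotation_generator_mult_component)
  \<comment> \<open>On the last eigenspace the polynomial takes the value 16 - 4 = 12, and
    projecting \<open>M\<close> there brings a factor 1/2 for each of the two matrices; hence 6. The
    identity is checked for each kind of entry and each choice of signs.\<close>
  show ?thesis
    unfolding vec_eq_iff
  proof (intro allI)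
    fix r s
    have "r = i \<or> r = j \<or> (r \<noteq> i \<and> r \<noteq> j)" "s = i \<or> s = j \<or> (s \<noteq> i \<and> s \<noteq> j)" by blast+
    with coeff_cases[of i] coeff_cases[of j]
    show "(ad (ad (ad (ad M))) + (a i * a j) *\<^sub>R ad (ad M)) $ r $ s
      = (6 *\<^sub>R ((M $ i $ i - M $ j $ j) *\<^sub>R (matrix_unit i i - matrix_unit j j)
         + (M $ i $ j + a i * a j * M $ j $ i) *\<^sub>R (matrix_unit i j + (a i * a j) *\<^sub>R matrix_unit j i))) $ r $ s"
      using assms(1) by (elim disjE; simp add: ad matrix_unit_component)
  qed
qed

text \<open>Irreducibility is made explicit: projecting \<open>B\<close> to a plane leaves a nonzero
  combination \<open>W\<close> of two matrices of that plane, and commutators of \<open>W\<close>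
  with rotations lead step by step to all matrix units.\<close>

lemma co_matrices_maximal:
  fixes G :: "(real^'n^'n) set"
  assumes card: "CARD('n) > 2" and G: "subspace G"
    and comm: "\<And>A B. A \<in> G \<Longrightarrow> B \<in> G \<Longrightarrow> A ** B - B ** A \<in> G"
    and co: "co_matrices a \<subseteq> G" and B: "B \<in> G" "B \<notin> co_matrices a"
  shows "G = UNIV"
proof -
  note sub = subspace_add[OF G] subspace_diff[OF G] subspace_scale[OF G]
  have cancel: "A \<in> G" if "c *\<^sub>R A \<in> G" "c \<noteq> 0" for c A
    using subspace_scale[OF G that(1), of "1 / c"] that(2) by simp
  let ?E = "matrix_unit :: 'n \<Rightarrow> 'n \<Rightarrow> _"
  let ?R = "rotation_generator a"
  have R: "?R i j \<in> G" for i j using co rotation_generator_co by blast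
  have proj: "(M $ i $ i - M $ j $ j) *\<^sub>R (?E i i - ?E j j)
       + (M $ i $ j + a i * a j * M $ j $ i) *\<^sub>R (?E i j + (a i * a j) *\<^sub>R ?E j i) \<in> G"
    if "i \<noteq> j" "M \<in> G" for i j M
    by (rule cancel[of 6], subst plane_projection_eq[OF that(1), symmetric])
      (auto intro!: sub comm R that)
  have offdiag: "?E i j \<in> G" "?E j i \<in> G" if "a j *\<^sub>R ?E i j + a i *\<^sub>R ?E j i \<in> G" for i j
  proof -
    let ?S = "a j *\<^sub>R ?E i j + a i *\<^sub>R ?E j i"
    have "(2 * a j) *\<^sub>R ?E i j = ?S + ?R i j" "(2 * a i) *\<^sub>R ?E j i = ?S - ?R i j"
      by (simp_all add: rotation_generator_def vec_eq_iff)
    then have "(2 * a j) *\<^sub>R ?E i j \<in> G" "(2 * a i) *\<^sub>R ?E j i \<in> G"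
      using sub(1)[OF that R[of i j]] sub(2)[OF that R[of i j]] by simp_all
    then show "?E i j \<in> G" "?E j i \<in> G" using cancel coeff_nonzero by simp_all
  qed
  have diag_of_off: "?E i i - ?E j j \<in> G" if "?E i j \<in> G" "?E j i \<in> G" for i j
    using comm[OF that] by (simp add: matrix_unit_mult)
  obtain i j where ij: "i \<noteq> j" and
    "B $ i $ i \<noteq> B $ j $ j \<or> a i * B $ i $ j + a j * B $ j $ i \<noteq> 0"
  proof (rule ccontr)
    assume "\<not> thesis"
    with that have *: "i \<noteq> j \<Longrightarrow> B $ i $ i = B $ j $ j \<and> a i * B $ i $ j + a j * B $ j $ i = 0" for i j
      by blast
    \<comment> \<open>Any index serves as reference; the common diagonal value gives the factor that
      would make \<open>B\<close> conformal.\<close>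
    obtain k :: 'n where True by blast
    have "a i * B $ i $ j + a j * B $ j $ i = (if i = j then (2 * B $ k $ k) * a i else 0)" for i j
      using * by (cases "i = k") auto
    then show False using B(2) unfolding co_matrices_entry_iff by blast
  qed
  define u v where "u = B $ i $ i - B $ j $ j" and "v = B $ i $ j + a i * a j * B $ j $ i"
  have "a i * v = a i * B $ i $ j + a j * B $ j $ i"
    by (simp add: v_def distrib_left mult.assoc[symmetric] square_one)
  then have uv: "u \<noteq> 0 \<or> v \<noteq> 0"
    using \<open>B $ i $ i \<noteq> _ \<or> _\<close> by (auto simp: u_def)
  define W where "W = u *\<^sub>R (?E i i - ?E j j) + v *\<^sub>R (?E i j + (a i * a j) *\<^sub>R ?E j i)"
  have W: "W \<in> G" using proj[OF ij B(1)] by (simp add: W_def u_def v_def)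
  \<comment> \<open>If \<open>u = 0\<close>, the off-diagonal part of \<open>W\<close> is already
    isolated. Otherwise project \<open>W\<close> to the plane of \<open>i\<close> and a third index,
    where it has no off-diagonal entries and only \<open>u\<close> remains.\<close>
  obtain k where k: "i \<noteq> k" "?E i i - ?E k k \<in> G"
  proof (cases "u = 0")
    case True
    then have "?E i j + (a i * a j) *\<^sub>R ?E j i \<in> G" using W uv cancel by (simp add: W_def)
    then have "a j *\<^sub>R (?E i j + (a i * a j) *\<^sub>R ?E j i) \<in> G" by (rule sub)
    moreover have "a j *\<^sub>R (?E i j + (a i * a j) *\<^sub>R ?E j i) = a j *\<^sub>R ?E i j + a i *\<^sub>R ?E j i"
      using square_one[of j] by (simp add: algebra_simps mult.left_commute)
    ultimately show ?thesis using that[OF ij] offdiag diag_of_off by metis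
  next
    case False
    obtain k where k: "k \<noteq> i" "k \<noteq> j" by (rule obtain_third_index[OF card])
    have "u *\<^sub>R (?E i i - ?E k k) \<in> G"
      using proj[OF k(1)[symmetric] W] k ij by (simp add: W_def matrix_unit_component)
    then show ?thesis using cancel False that k by metis
  qed
  have ij_in: "?E i j \<in> G" "?E j i \<in> G" if "j \<noteq> i" for j
  proof -
    \<comment> \<open>For \<open>j = k\<close> both diagonal entries contribute, which doubles the
      factor.\<close>
    have "?R i j ** (?E i i - ?E k k) - (?E i i - ?E k k) ** ?R i j
      = (if j = k then - 2 else - 1) *\<^sub>R (a j *\<^sub>R ?E i j + a i *\<^sub>R ?E j i)"
      using that k(1)
      by (auto simp: vec_eq_iff rotation_generator_mult_component matrix_unit_component)
    then have "(if j = k then - 2 else - 1) *\<^sub>R (a j *\<^sub>R ?E i j + a i *\<^sub>R ?E j i) \<in> G"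
      using comm[OF R[of i j] k(2)] by simp
    then have "a j *\<^sub>R ?E i j + a i *\<^sub>R ?E j i \<in> G" by (rule cancel) auto
    then show "?E i j \<in> G" "?E j i \<in> G" using offdiag by blast+
  qed
  have off: "?E j l \<in> G" if "j \<noteq> l" for j l
  proof (cases "j = i \<or> l = i")
    case True
    then show ?thesis using ij_in that by metis
  next
    case False
    then show ?thesis using comm[OF ij_in(2)[of j] ij_in(1)[of l]] that by (simp add: matrix_unit_mult)
  qed
  then have diff: "?E i i - ?E j j \<in> G" for j
    using diag_of_off subspace_0[OF G] by (cases "i = j") auto
  have "(if r = s then 1 else 0) = (\<Sum>j\<in>UNIV. if r = j \<and> s = j then 1 else (0::real))" for r s :: 'n
  proof -
    have *: "(\<lambda>j. if r = j \<and> s = j then 1 else (0::real)) = (\<lambda>j. if j = r then if r = s then 1 else 0 else 0)"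
      by auto
    show ?thesis unfolding * by simp
  qed
  then have "(mat 1 :: real^'n^'n) = (\<Sum>j\<in>UNIV. ?E j j)"
    by (simp add: vec_eq_iff mat_def matrix_unit_component)
  \<comment> \<open>The differences of diagonal units are trace-free; \<open>mat 1\<close> supplies
    the missing trace.\<close>
  then have "real CARD('n) *\<^sub>R ?E i i = mat 1 + (\<Sum>j\<in>UNIV. ?E i i - ?E j j)"
    by (simp add: sum_subtractf sum_constant_scaleR del: sum_constant)
  moreover have "mat 1 + (\<Sum>j\<in>UNIV. ?E i i - ?E j j) \<in> G"
    by (intro sub(1) subspace_sum[OF G] diff subsetD[OF co] co_matrices_mat)
  ultimately have "real CARD('n) *\<^sub>R ?E i i \<in> G" by (simp only:)
  then have ii: "?E i i \<in> G" using cancel[of "real CARD('n)"] by simp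
  have "?E j l \<in> G" for j l
    using off sub(2)[OF ii diff[of j]] by (cases "j = l") auto
  then have "A \<in> G" for A
    by (subst matrix_unit_expansion) (intro subspace_sum[OF G] sub)
  then show ?thesis by blast
qed

end

section \<open>Lie algebras containing all fields of degree at most two\<close>

text \<open>One coordinate factor is added at a time, as in \<open>homogeneous_step\<close>. The
  zero function is homogeneous of every degree.\<close>

inductive homogeneous :: "nat \<Rightarrow> (real^'n \<Rightarrow> real) \<Rightarrow> bool" where
  const: "homogeneous 0 (\<lambda>x. c)"
| coordinate: "homogeneous d f \<Longrightarrow> homogeneous (Suc d) (\<lambda>x. x $ j * f x)"
| add: "homogeneous d f \<Longrightarrow> homogeneous d g \<Longrightarrow> homogeneous d (\<lambda>x. f x + g x)"

lemma homogeneous_polynomial: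
  "homogeneous d f \<Longrightarrow> real_polynomial_function (f :: real^'n::finite \<Rightarrow> real)"
  by (induction rule: homogeneous.induct)
    (auto intro: real_polynomial_function.intros(2-4) real_polynomial_function_coordinate)

lemmas polynomial_differentiable =
  differentiable_at_real_polynomial_function[OF real_polynomial_function_coordinate]
  differentiable_at_real_polynomial_function[OF homogeneous_polynomial]

lemma homogeneous_euler:
  "homogeneous d f \<Longrightarrow> dderiv x f x = real d * f (x :: real^'n::finite)"
  by (induction rule: homogeneous.induct)
    (auto simp: dderiv_mult dderiv_add polynomial_differentiable algebra_simps)

text \<open>The factor \<open>x $ i\<close> restores the degree lost by differentiating, so no case
  \<open>d - 1\<close> arises. This yields the auxiliary function of
  \<open>homogeneous_step\<close>.\<close>

lemma homogeneous_coordinate_dderiv: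
  "homogeneous d f \<Longrightarrow> homogeneous d (\<lambda>x::real^'n::finite. x $ i * dderiv (axis i 1) f x)"
proof (induction rule: homogeneous.induct)
  case (const c)
  show ?case by (simp add: homogeneous.const)
next
  case (coordinate d f j)
  have *: "homogeneous (Suc d) (\<lambda>x. x $ i * (if i = j then f x else 0))"
    if "homogeneous d f" for f
  proof (cases "i = j")
    case False
    have "homogeneous d (\<lambda>x::real^'n. 0)" for d
    proof (induction d)
      case (Suc d)
      then show ?case using homogeneous.coordinate[of d "\<lambda>x. 0"] by simp
    qed (rule homogeneous.const)
    then show ?thesis using False by simp
  qed (simp add: that homogeneous.coordinate)
  have "(\<lambda>x. x $ i * dderiv (axis i 1) (\<lambda>x. x $ j * f x) x)
    = (\<lambda>x. x $ j * (x $ i * dderiv (axis i 1) f x) + x $ i * (if i = j then f x else 0))"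
    using coordinate
    by (auto simp: dderiv_mult polynomial_differentiable axis_component algebra_simps)
  then show ?case
    using homogeneous.add[OF homogeneous.coordinate[OF coordinate.IH] *[OF coordinate.hyps]] by simp
next
  case (add d f g)
  then show ?case
    using homogeneous.add[OF add.IH]
    by (simp add: dderiv_add polynomial_differentiable algebra_simps)
qed

lemma homogeneous_scale: "homogeneous d f \<Longrightarrow> homogeneous d (\<lambda>x. c * f x)"
proof (induction rule: homogeneous.induct)
  case (coordinate d f j)
  then show ?case using homogeneous.coordinate[OF coordinate.IH] by (simp add: algebra_simps)
next
  case (add d f g)
  then show ?case using homogeneous.add[OF add.IH] by (simp add: algebra_simps)
qed (rule homogeneous.const)

lemma homogeneous_mult:
  "homogeneous d f \<Longrightarrow> homogeneous e g \<Longrightarrow> homogeneous (d + e) (\<lambda>x. f x * g x)"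
proof (induction rule: homogeneous.induct)
  case (const c)
  then show ?case by (simp add: homogeneous_scale)
next
  case (coordinate d f j)
  then show ?case
    using homogeneous.coordinate[OF coordinate.IH[OF coordinate.prems]] by (simp add: mult.assoc)
next
  case (add d f f')
  then show ?case using homogeneous.add[of "d + e"] by (simp add: distrib_right)
qed

inductive homogeneous_sum :: "(real^'n \<Rightarrow> real) \<Rightarrow> bool" where
  homogeneous: "homogeneous d f \<Longrightarrow> homogeneous_sum f"
| add: "homogeneous_sum f \<Longrightarrow> homogeneous_sum g \<Longrightarrow> homogeneous_sum (\<lambda>x. f x + g x)"

lemma homogeneous_sum_mult:
  "homogeneous_sum f \<Longrightarrow> homogeneous_sum g \<Longrightarrow> homogeneous_sum (\<lambda>x. f x * g x)"
proof (induction rule: homogeneous_sum.induct)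
  case (homogeneous d f)
  from homogeneous.prems homogeneous.hyps show ?case
  proof (induction rule: homogeneous_sum.induct)
    case (homogeneous e g)
    then show ?case using homogeneous_mult homogeneous_sum.homogeneous by blast
  next
    case (add g h)
    then show ?case using homogeneous_sum.add by (simp add: distrib_left)
  qed
next
  case (add f g)
  then show ?case using homogeneous_sum.add by (simp add: distrib_right)
qed

lemma homogeneous_sum_polynomial:
  "real_polynomial_function f \<Longrightarrow> homogeneous_sum (f :: real^'n::finite \<Rightarrow> real)"
proof (induction rule: real_polynomial_function.induct)
  case (linear f)
  have coord: "homogeneous_sum (\<lambda>x. x $ i * c)" for i c
    using homogeneous.coordinate[OF homogeneous.const] homogeneous_sum.homogeneous by blast
  have "homogeneous_sum (\<lambda>x. \<Sum>i\<in>I. x $ i * f (axis i 1))" if "finite I" for I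
    using that
  proof (induction I)
    case empty
    then show ?case by (simp add: homogeneous_sum.homogeneous[OF homogeneous.const])
  next
    case (insert i I)
    then show ?case using homogeneous_sum.add[OF coord] by simp
  qed
  then have "homogeneous_sum (\<lambda>x. \<Sum>i\<in>UNIV. x $ i * f (axis i 1))" by simp
  moreover have "(\<lambda>x. \<Sum>i\<in>UNIV. x $ i * f (axis i 1)) = f"
    using linear_vec_axis[OF bounded_linear.linear[OF linear]] by (metis (no_types, lifting) ext real_scaleR_def sum.cong)
  ultimately show ?case by (simp only:)
next
  case (const c)
  then show ?case by (rule homogeneous_sum.homogeneous[OF homogeneous.const])
qed (auto intro: homogeneous_sum.add homogeneous_sum_mult)

section \<open>Fields along one coordinate direction and raising their degree\<close>

definition coordinate_field :: "(real^'n \<Rightarrow> real) \<Rightarrow> 'n \<Rightarrow> ('n::finite) vec_field" where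
  "coordinate_field f i = (\<lambda>x. f x *\<^sub>R axis i 1)"

lemma dderiv_coordinate_field:
  assumes "\<And>x. f differentiable at x"
  shows "dderiv v (coordinate_field f i) = coordinate_field (dderiv v f) i"
  unfolding coordinate_field_def
  by (rule dderiv_bounded_linear_compose[OF bounded_linear_scaleR_left assms])

lemma dderiv_scaleR_direction:
  assumes "f differentiable at x"
  shows "dderiv (c *\<^sub>R v) f x = c *\<^sub>R dderiv v f x"
  using linear_scale[OF linear_dderiv[OF assms]] by simp

lemma vf_bracket_coordinate_field:
  assumes "real_polynomial_function f" "real_polynomial_function g"
  shows "vf_bracket (coordinate_field f i) (coordinate_field g j)
    = (\<lambda>x. (f x * dderiv (axis i 1) g x) *\<^sub>R axis j 1 - (g x * dderiv (axis j 1) f x) *\<^sub>R axis i 1)"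
  using assms[THEN differentiable_at_real_polynomial_function]
  by (simp add: vf_bracket_dderiv dderiv_coordinate_field)
    (simp add: coordinate_field_def dderiv_scaleR_direction)

lemma vec_field_expansion: "X = (\<lambda>x. \<Sum>i\<in>UNIV. coordinate_field (\<lambda>x. X x $ i) i x)"
  by (simp add: coordinate_field_def basis_expansion scalar_mult_eq_scaleR[symmetric])

text \<open>By Euler's identity the first field acts on \<open>f\<close> with factor
  \<open>real d\<close>; differentiating its factor \<open>x\<close> takes away 1, and
  differentiating \<open>x $ j\<close> gives the correction for \<open>i = j\<close>.\<close>

lemma vf_bracket_euler:
  fixes f :: "real^'n::finite \<Rightarrow> real"
  assumes "homogeneous d f"
  shows "vf_bracket (\<lambda>x. x $ j *\<^sub>R x) (coordinate_field f i)
    = (\<lambda>x. ((real d - 1) * (x $ j * f x)) *\<^sub>R axis i 1 - (if i = j then f x else 0) *\<^sub>R x)"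
proof -
  have "((\<lambda>x::real^'n. x $ j *\<^sub>R x) has_derivative (\<lambda>v. x $ j *\<^sub>R v + v $ j *\<^sub>R x)) (at x)" for x
    by (auto intro!: derivative_eq_intros bounded_linear.has_derivative[OF bounded_linear_vec_nth])
  note D = dderiv_eq[OF this]
  show ?thesis
    using polynomial_differentiable(2)[OF assms] homogeneous_euler[OF assms]
    by (auto simp: vf_bracket_dderiv dderiv_coordinate_field D)
     (auto simp: coordinate_field_def dderiv_scaleR_direction axis_component algebra_simps)
qed

locale vec_field_lie_algebra =
  fixes L :: "('n::finite) vec_field set"
  assumes lie: "lie_subalgebra L"
begin

lemma closed_zero: "(\<lambda>x. 0) \<in> L"
  and closed_add: "X \<in> L \<Longrightarrow> Y \<in> L \<Longrightarrow> (\<lambda>x. X x + Y x) \<in> L"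
  and closed_scaleR: "X \<in> L \<Longrightarrow> (\<lambda>x. c *\<^sub>R X x) \<in> L"
  and closed_bracket: "X \<in> L \<Longrightarrow> Y \<in> L \<Longrightarrow> vf_bracket X Y \<in> L"
  and closed_poly: "X \<in> L \<Longrightarrow> X \<in> poly_vec_fields"
  using lie unfolding lie_subalgebra_def by blast+

lemma closed_diff: "X \<in> L \<Longrightarrow> Y \<in> L \<Longrightarrow> (\<lambda>x. X x - Y x) \<in> L"
  using closed_add[OF _ closed_scaleR[of Y "-1"], of X] by simp

lemma closed_sum: "finite I \<Longrightarrow> (\<And>i. i \<in> I \<Longrightarrow> X i \<in> L) \<Longrightarrow> (\<lambda>x. \<Sum>i\<in>I. X i x) \<in> L"
  by (induction I rule: finite_induct) (auto intro: closed_zero closed_add)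

lemma closed_cancel:
  assumes "(\<lambda>x. c *\<^sub>R X x) \<in> L" "c \<noteq> 0"
  shows "X \<in> L"
  using closed_scaleR[OF assms(1), of "1 / c"] assms(2) by simp

text \<open>
  For \<open>i \<noteq> j\<close> the bracket with \<open>x\<^sub>j E\<close> (\<open>E\<close> the Euler field) suffices. For \<open>i = j\<close> it leaves a
  multiple of \<open>f E\<close>, so \<open>x\<^sub>i f \<partial>\<^sub>i\<close> is instead extracted from the brackets of \<open>f \<partial>\<^sub>k\<close> with
  \<open>x\<^sub>k x\<^sub>i \<partial>\<^sub>i\<close> and of \<open>f \<partial>\<^sub>i\<close> with \<open>x\<^sub>i\<^sup>2 \<partial>\<^sub>i\<close>.
\<close>

lemma homogeneous_step:
  assumes quadratic: "\<And>i j k. coordinate_field (\<lambda>x. x $ j * x $ k) i \<in> L"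
    and degree: "\<And>f i. homogeneous d f \<Longrightarrow> coordinate_field f i \<in> L" "d \<noteq> 1"
    and card: "CARD('n) > 1" and f: "homogeneous d f"
  shows "coordinate_field (\<lambda>x. x $ j * f x) i \<in> L"
proof -
  have "(\<lambda>x. \<Sum>i\<in>UNIV. coordinate_field (\<lambda>x. (x $ j *\<^sub>R x) $ i) i x) \<in> L" for j
    by (rule closed_sum) (simp_all add: quadratic)
  then have euler: "(\<lambda>x. x $ j *\<^sub>R x) \<in> L" for j
    by (simp only: vec_field_expansion[symmetric])
  note bracket = closed_bracket[OF euler degree(1)]
  show ?thesis
  proof (cases "i = j")
    case False
    have "(\<lambda>x. (real d - 1) *\<^sub>R coordinate_field (\<lambda>x. x $ j * f x) i x) \<in> L"
      using bracket[OF f, of j i] vf_bracket_euler[OF f, of j i] False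
      by (simp add: coordinate_field_def)
    then show ?thesis by (rule closed_cancel) (use degree(2) in simp)
  next
    case True
    obtain k where k: "k \<noteq> i"
    proof -
      have "UNIV \<noteq> {i}" using card by (metis card.empty card.insert empty_iff finite.emptyI less_irrefl One_nat_def)
      then show thesis using that by blast
    qed
    let ?f' = "\<lambda>x. x $ i * dderiv (axis i 1) f x"
    have f': "homogeneous d ?f'" using f by (rule homogeneous_coordinate_dderiv)
    \<comment> \<open>Both brackets leave the same multiple of the Euler field, which cancels in the
      difference.\<close>
    have "(\<lambda>x. (real d - 1) *\<^sub>R ((x $ i * ?f' x) *\<^sub>R axis i 1 - (x $ k * ?f' x) *\<^sub>R axis k 1)) \<in> L"
      using closed_diff[OF bracket[OF f', of i i] bracket[OF f', of k k]]
      by (simp add: vf_bracket_euler[OF f'] algebra_simps)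
    then have 1: "(\<lambda>x. (x $ i * ?f' x) *\<^sub>R axis i 1 - (x $ k * ?f' x) *\<^sub>R axis k 1) \<in> L"
      by (rule closed_cancel) (use degree(2) in simp)
    have prod: "real_polynomial_function (\<lambda>x::real^'n. x $ j * x $ k)" for j k
      by (intro real_polynomial_function.intros(4) real_polynomial_function_coordinate)
    note coordinate_bracket = vf_bracket_coordinate_field[OF homogeneous_polynomial[OF f] prod]
    have 2: "(\<lambda>x. (f x * x $ i) *\<^sub>R axis i 1 - (x $ k * ?f' x) *\<^sub>R axis k 1) \<in> L"
      using closed_bracket[OF degree(1)[OF f, of k] quadratic[of k i i]] k
      by (simp add: coordinate_bracket dderiv_mult polynomial_differentiable axis_component algebra_simps)
    have 3: "(\<lambda>x. (2 * f x * x $ i) *\<^sub>R axis i 1 - (x $ i * ?f' x) *\<^sub>R axis i 1) \<in> L"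
      using closed_bracket[OF degree(1)[OF f, of i] quadratic[of i i i]]
      by (simp add: coordinate_bracket dderiv_mult polynomial_differentiable axis_component algebra_simps)
    \<comment> \<open>Fact \<open>3\<close> minus \<open>2\<close> plus \<open>1\<close>: all terms
      in \<open>?f'\<close> cancel.\<close>
    have "coordinate_field (\<lambda>x. x $ j * f x) i = (\<lambda>x. ((2 * f x * x $ i) *\<^sub>R axis i 1 - (x $ i * ?f' x) *\<^sub>R axis i 1)
      - ((f x * x $ i) *\<^sub>R axis i 1 - (x $ k * ?f' x) *\<^sub>R axis k 1)
      + ((x $ i * ?f' x) *\<^sub>R axis i 1 - (x $ k * ?f' x) *\<^sub>R axis k 1))"
      by (simp add: True coordinate_field_def fun_eq_iff vec_eq_iff algebra_simps)
    then show ?thesis using closed_add[OF closed_diff[OF 3 2] 1] by simp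
  qed
qed

lemma homogeneous_zero_const: "homogeneous d f \<Longrightarrow> d = 0 \<Longrightarrow> \<exists>c. f = (\<lambda>x. c)"
  by (induction rule: homogeneous.induct) auto

lemma eq_poly_vec_fields_if_quadratic:
  assumes const: "\<And>i. coordinate_field (\<lambda>x. 1) i \<in> L"
    and linear: "\<And>i j. coordinate_field (\<lambda>x. x $ j) i \<in> L"
    and quadratic: "\<And>i j k. coordinate_field (\<lambda>x. x $ j * x $ k) i \<in> L"
    and card: "CARD('n) > 1"
  shows "L = poly_vec_fields"
proof -
  have scale: "coordinate_field (\<lambda>x. f x * c) i \<in> L" if "coordinate_field f i \<in> L" for c f i
    using closed_scaleR[OF that, of c] by (simp add: coordinate_field_def mult.commute)
  have coord_add: "coordinate_field (\<lambda>x. f x + g x) i \<in> L"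
    if "coordinate_field f i \<in> L" "coordinate_field g i \<in> L" for f g i
    using closed_add[OF that] by (simp add: coordinate_field_def scaleR_left_distrib)
  have zero: "coordinate_field f i \<in> L" if "homogeneous 0 f" for f i
    using homogeneous_zero_const[OF that] scale[OF const] by fastforce
  \<comment> \<open>The factor \<open>real d - 1\<close> vanishes in degree 1, so this passage rests
    on the hypothesis \<open>quadratic\<close>.\<close>
  have step1: "coordinate_field (\<lambda>x. x $ j * f x) i \<in> L" if "homogeneous (Suc 0) f" for f i j
    using that
  proof (induction "Suc 0" f rule: homogeneous.induct)
    case (coordinate f k)
    then obtain c where "f = (\<lambda>x. c)" using homogeneous_zero_const by metis
    then show ?case using scale[OF quadratic, of j k c i] by (simp add: mult.assoc)
  next
    case (add f g)
    then show ?case using coord_add by (simp add: distrib_left)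
  qed
  have hom: "homogeneous d f \<Longrightarrow> coordinate_field f i \<in> L" for d f i
  proof (induction d arbitrary: f i)
    case 0
    then show ?case by (rule zero)
  next
    case (Suc d)
    have step: "coordinate_field (\<lambda>x. x $ j * f x) i \<in> L" if "homogeneous d f" for f i j
      using step1 homogeneous_step[OF quadratic Suc.IH _ card that] that by (cases "d = 1") auto
    from Suc.prems show ?case
      by (induction "Suc d" f rule: homogeneous.induct) (auto intro: step coord_add)
  qed
  have "coordinate_field f i \<in> L" if "real_polynomial_function f" for f i
    using homogeneous_sum_polynomial[OF that]
    by (induction rule: homogeneous_sum.induct) (auto intro: hom coord_add)
  then have "X \<in> L" if "X \<in> poly_vec_fields" for X
    using that by (subst vec_field_expansion) (intro closed_sum, auto simp: poly_vec_fields_def)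
  then show ?thesis using closed_poly by blast
qed

end

section \<open>Maximality of the conformal algebra\<close>

lemma vf_bracket_matrix:
  fixes A B :: "real^'n::finite^'n"
  shows "vf_bracket (\<lambda>x. A *v x) (\<lambda>x. B *v x) = (\<lambda>x. (B ** A - A ** B) *v x)"
  by (simp add: vf_bracket_dderiv dderiv_matrix matrix_vector_mult_diff_rdistrib matrix_vector_mul_assoc)

lemma coordinate_field_matrix_unit: "coordinate_field (\<lambda>x. x $ j) i = (\<lambda>x. matrix_unit i j *v x)"
  by (simp add: coordinate_field_def matrix_unit_vector_mult)

lemma sharp_coordinate: "sharp a (\<lambda>x. x $ i) = a i *\<^sub>R axis i 1"
  by (simp add: sharp_def vec_eq_iff axis_component)

lemma linear_coordinate: "linear (\<lambda>x::real^'n. x $ i)"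
  by (rule bounded_linear.linear[OF bounded_linear_vec_nth])

locale conformal_extension = orthonormal_signature a + vec_field_lie_algebra L
  for a :: "'n::finite \<Rightarrow> real" and L :: "'n vec_field set"
begin

lemma quadratic_coordinate_fields:
  assumes linear: "\<And>i j. coordinate_field (\<lambda>x. x $ j) i \<in> L"
    and Q: "\<And>i. quadratic_vf a (\<lambda>x. x $ i) \<in> L"
  shows "coordinate_field (\<lambda>x. x $ j * x $ k) i \<in> L"
proof -
  have prod: "real_polynomial_function (\<lambda>x::real^'n. x $ j * x $ k)" for j k
    by (intro real_polynomial_function.intros(4) real_polynomial_function_coordinate)
  note bracket = vf_bracket_coordinate_field[OF real_polynomial_function_coordinate prod]
  note simps = bracket dderiv_mult polynomial_differentiable axis_component
  \<comment> \<open>The field \<open>x_j d_j\<close> commutes with \<open>x_i\<close> times the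
    Euler field, so only the \<open>j\<close>-th square inside the metric term survives.\<close>
  have square: "coordinate_field (\<lambda>x. x $ j * x $ j) i \<in> L" if "j \<noteq> i" for i j
  proof (rule closed_cancel)
    have "vf_bracket (coordinate_field (\<lambda>x. x $ j) j) (quadratic_vf a (\<lambda>x. x $ i))
      = (\<lambda>x. (- (a i * a j)) *\<^sub>R coordinate_field (\<lambda>x. x $ j * x $ j) i x)"
      using that
      by (simp add: vf_bracket_dderiv dderiv_coordinate_field polynomial_differentiable
          dderiv_quadratic_vf linear_coordinate sharp_coordinate)
        (simp add: coordinate_field_def quadratic_vf_metric sharp_coordinate axis_component
          metric_simps metric_axis algebra_simps)
    then show "(\<lambda>x. (- (a i * a j)) *\<^sub>R coordinate_field (\<lambda>x. x $ j * x $ j) i x) \<in> L"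
      using closed_bracket[OF linear Q] by metis
  qed (simp add: coeff_nonzero)
  \<comment> \<open>Bracketing with \<open>x_k d_j\<close> polarises the square.\<close>
  have offdiag: "coordinate_field (\<lambda>x. x $ j * x $ k) i \<in> L" if "j \<noteq> i" "k \<noteq> i" for i j k
  proof (cases "j = k")
    case False
    have "(\<lambda>x. 2 *\<^sub>R coordinate_field (\<lambda>x. x $ j * x $ k) i x) \<in> L"
      using closed_bracket[OF linear[of k j] square[OF that(1)]] that False
      by (simp add: simps) (simp add: coordinate_field_def algebra_simps)
    then show ?thesis by (rule closed_cancel) simp
  qed (use square that in simp)
  have mixed: "(\<lambda>x. (2 * (x $ i * x $ k)) *\<^sub>R axis k 1 - (x $ i * x $ i) *\<^sub>R axis i 1) \<in> L"
    if "k \<noteq> i" for i k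
    using closed_bracket[OF linear[of k i] square[OF that[symmetric]]] that
    by (simp add: simps algebra_simps)
  have diag: "coordinate_field (\<lambda>x. x $ i * x $ i) i \<in> L" for i
  proof (rule closed_cancel)
    let ?I = "UNIV - {i}"
    \<comment> \<open>Twice the quadratic field contains \<open>x_i^2 d_i\<close> once, after its
      own metric term is deducted. The squares for \<open>k \<noteq> i\<close> remove the rest of
      the metric term, the mixed fields remove the cross terms, and each mixed field adds one more
      copy: \<open>CARD('n)\<close> in total.\<close>
    have "(\<lambda>x. 2 *\<^sub>R quadratic_vf a (\<lambda>x. x $ i) x
        + (\<Sum>k\<in>?I. (a i * a k) *\<^sub>R coordinate_field (\<lambda>x. x $ k * x $ k) i x)
        - (\<Sum>k\<in>?I. (2 * (x $ i * x $ k)) *\<^sub>R axis k 1 - (x $ i * x $ i) *\<^sub>R axis i 1)) \<in> L"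
      by (intro closed_diff closed_add closed_scaleR closed_sum Q square mixed) auto
    moreover have "2 *\<^sub>R quadratic_vf a (\<lambda>x. x $ i) x
        + (\<Sum>k\<in>?I. (a i * a k) *\<^sub>R coordinate_field (\<lambda>x. x $ k * x $ k) i x)
        - (\<Sum>k\<in>?I. (2 * (x $ i * x $ k)) *\<^sub>R axis k 1 - (x $ i * x $ i) *\<^sub>R axis i 1)
      = real CARD('n) *\<^sub>R coordinate_field (\<lambda>x. x $ i * x $ i) i x" for x
    proof -
      have "x = (\<Sum>k\<in>UNIV. x $ k *\<^sub>R axis k 1)"
        by (simp add: basis_expansion scalar_mult_eq_scaleR[symmetric])
      then have x: "x = x $ i *\<^sub>R axis i 1 + (\<Sum>k\<in>?I. x $ k *\<^sub>R axis k 1)"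
        by (simp add: sum.remove[of UNIV i])
      have Q: "2 *\<^sub>R quadratic_vf a (\<lambda>x. x $ i) x = (2 * x $ i) *\<^sub>R x - (a i * metric a x x) *\<^sub>R axis i 1"
        by (simp add: quadratic_vf_metric sharp_coordinate scaleR_diff_right mult.commute)
      have two: "(2 * c) *\<^sub>R v = c *\<^sub>R v + c *\<^sub>R v" for c and v :: "real^'n"
        by (simp add: scaleR_left_distrib[symmetric])
      let ?e = "(x $ i * x $ i) *\<^sub>R axis i (1::real)"
      let ?S = "\<Sum>k\<in>?I. (2 * (x $ i * x $ k)) *\<^sub>R axis k (1::real)"
      let ?T = "\<Sum>k\<in>?I. (a i * a k) *\<^sub>R coordinate_field (\<lambda>x. x $ k * x $ k) i x"
      have "a i * metric a x x = x $ i * x $ i + (\<Sum>k\<in>?I. a i * a k * (x $ k * x $ k))"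
        by (simp add: metric_def sum.remove[of UNIV i] distrib_left sum_distrib_left mult.assoc[symmetric]
            square_one)
      then have T: "(a i * metric a x x) *\<^sub>R axis i 1 = ?e + ?T"
        by (simp add: coordinate_field_def scaleR_add_left scaleR_sum_left)
      have S: "(2 * x $ i) *\<^sub>R x = ?e + ?e + ?S"
        by (subst x) (simp only: scaleR_add_right scaleR_sum_right scaleR_scaleR mult.assoc
            two[of "x $ i * x $ i" "axis i 1"])
      have D: "(\<Sum>k\<in>?I. (2 * (x $ i * x $ k)) *\<^sub>R axis k 1 - ?e) = ?S - (real CARD('n) - 1) *\<^sub>R ?e"
        by (simp add: sum_subtractf sum_constant_scaleR card_Diff_singleton of_nat_diff del: sum_constant)
      have "(e + e + S) - (e + T) + T - (S - (c - 1) *\<^sub>R e) = c *\<^sub>R e" for c and e S T :: "real^'n"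
        by (simp add: scaleR_diff_left)
      then show ?thesis
        by (simp only: Q S T D coordinate_field_def[of "\<lambda>x. x $ i * x $ i"])
    qed
    ultimately show "(\<lambda>x. real CARD('n) *\<^sub>R coordinate_field (\<lambda>x. x $ i * x $ i) i x) \<in> L"
      by (simp only:)
  qed simp
  have on: "coordinate_field (\<lambda>x. x $ i * x $ k) i \<in> L" for i k
  proof (cases "k = i")
    case False
    have "(\<lambda>x. 2 *\<^sub>R coordinate_field (\<lambda>x. x $ i * x $ k) i x) \<in> L"
      using closed_add[OF mixed[of i k] diag[of k]] False
      by (simp add: coordinate_field_def mult.commute)
    then show ?thesis by (rule closed_cancel) simp
  qed (use diag in simp)
  show ?thesis
    using offdiag on on[of i j] by (metis (no_types, lifting) mult.commute ext)
qed

end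

context orthonormal_signature
begin

text \<open>Under a change of sign of \<open>x\<close> the constant and quadratic parts are even, so
  comparing odd parts identifies \<open>A\<close> with the conformal matrix.\<close>

lemma matrix_field_conformal_iff:
  "(\<lambda>x. A *v x) \<in> conformal_algebra a \<longleftrightarrow> A \<in> co_matrices a"
proof
  assume "(\<lambda>x. A *v x) \<in> conformal_algebra a"
  then obtain h B \<alpha> where eq: "(\<lambda>x. A *v x) = conformal_field a h B \<alpha>"
    and B: "B \<in> co_matrices a" and \<alpha>: "linear \<alpha>"
    unfolding conformal_algebra_eq by blast
  have "A *v x = B *v x" for x
  proof -
    have even: "quadratic_vf a \<alpha> (- x) = quadratic_vf a \<alpha> x"
      by (simp add: quadratic_vf_def linear_neg[OF \<alpha>])
    have neg: "M *v (- x) = - (M *v x)" for M :: "real^'n^'n"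
      by (simp add: linear_neg)
    have "A *v x = h + B *v x + quadratic_vf a \<alpha> x" "- (A *v x) = h - B *v x + quadratic_vf a \<alpha> x"
      using fun_cong[OF eq, of x] fun_cong[OF eq, of "- x"] by (simp_all add: conformal_field_def even neg)
    then have "2 *\<^sub>R (A *v x) = 2 *\<^sub>R (B *v x)" by (simp add: scaleR_2 algebra_simps)
    then show ?thesis by simp
  qed
  then show "A \<in> co_matrices a" using B matrix_eq by metis
next
  assume "A \<in> co_matrices a"
  moreover have "(\<lambda>x. A *v x) = conformal_field a 0 A (\<lambda>x. 0)"
    by (auto simp: conformal_field_def quadratic_vf_def sharp_def vec_eq_iff)
  ultimately show "(\<lambda>x. A *v x) \<in> conformal_algebra a"
    unfolding conformal_algebra_eq using linear_zero by blast
qed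

lemma quadratic_vf_conformal: "linear \<alpha> \<Longrightarrow> quadratic_vf a \<alpha> \<in> conformal_algebra a"
  unfolding conformal_algebra_eq using co_matrices_zero[of a]
  by (auto intro!: exI[of _ 0] simp: conformal_field_def)

lemma const_conformal: "(\<lambda>x. h) \<in> conformal_algebra a"
proof -
  have "(\<lambda>x. h) = conformal_field a h 0 (\<lambda>x. 0)"
    by (auto simp: conformal_field_def quadratic_vf_def sharp_def vec_eq_iff)
  then show ?thesis
    unfolding conformal_algebra_eq using linear_zero co_matrices_zero by blast
qed

theorem maximal_conformal_algebra:
  assumes card: "CARD('n) > 2"
  shows "maximal_lie_subalgebra (conformal_algebra a)"
  unfolding maximal_lie_subalgebra_def
proof (intro conjI allI impI)
  show "lie_subalgebra (conformal_algebra a)" by (rule lie_subalgebra_conformal_algebra)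
  then have poly: "conformal_algebra a \<subseteq> poly_vec_fields" by (simp add: lie_subalgebra_def)
  obtain i j :: 'n where "j \<noteq> i" using obtain_third_index[OF card] by metis
  have "matrix_unit i j \<notin> co_matrices a"
  proof
    assume "matrix_unit i j \<in> co_matrices a"
    then obtain c where c: "\<And>r s. a r * matrix_unit i j $ r $ s + a s * matrix_unit i j $ s $ r
        = (if r = s then c * a r else 0)"
      unfolding co_matrices_entry_iff by blast
    show False
      using c[of i j] \<open>j \<noteq> i\<close> coeff_nonzero[of i] by (simp add: matrix_unit_component)
  qed
  then have "(\<lambda>x. matrix_unit i j *v x) \<notin> conformal_algebra a"
    by (simp add: matrix_field_conformal_iff)
  then show "conformal_algebra a \<subset> poly_vec_fields" using poly poly_vec_fields_matrix by blast
next
  fix L assume L: "lie_subalgebra L \<and> conformal_algebra a \<subset> L"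
  then interpret conformal_extension a L by unfold_locales auto
  have sub: "conformal_algebra a \<subseteq> L" using L by blast
  define G where "G = {A. (\<lambda>x. A *v x) \<in> L}"
  have G: "subspace G"
  proof (rule subspaceI)
    show "0 \<in> G" using closed_zero by (simp add: G_def matrix_vector_mult_0[abs_def])
    show "A + B \<in> G" if "A \<in> G" "B \<in> G" for A B
      using closed_add that by (simp add: G_def matrix_vector_mult_add_rdistrib[abs_def])
    show "c *\<^sub>R A \<in> G" if "A \<in> G" for c A
      using closed_scaleR that by (simp add: G_def scaleR_matrix_vector_assoc[symmetric, abs_def])
  qed
  have co: "co_matrices a \<subseteq> G"
    using sub matrix_field_conformal_iff by (auto simp: G_def)
  have comm: "A ** B - B ** A \<in> G" if "A \<in> G" "B \<in> G" for A B
    using closed_bracket[of "\<lambda>x. B *v x" "\<lambda>x. A *v x"] that by (simp add: G_def vf_bracket_matrix)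
  have "\<not> G \<subseteq> co_matrices a"
  proof
    assume G_co: "G \<subseteq> co_matrices a"
    \<comment> \<open>Membership in \<open>L\<close> is kept inside the induction because it passes
      to derivatives.\<close>
    have "X \<in> L \<Longrightarrow> X \<in> conformal_algebra a" if "X \<in> poly_vec_fields" for X
      using that
    proof (induction rule: poly_vec_field_induct)
      case zero
      show ?case by (rule const_conformal)
    next
      case (dderiv X)
      have "dderiv v X \<in> L" for v
        using closed_bracket[OF subsetD[OF sub const_conformal] dderiv.prems] by (simp add: vf_bracket_const)
      then obtain h A \<alpha> where \<alpha>: "linear \<alpha>" and X: "X = conformal_field a h A \<alpha>"
        using conformal_field_if_dderiv_conformal[OF card dderiv.hyps dderiv.IH] by metis
      \<comment> \<open>Removing the constant and quadratic parts, both in \<open>L\<close>, leaves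
        the linear field of \<open>A\<close>, so conformality of \<open>A\<close> follows from
        \<open>G_co\<close>.\<close>
      have "(\<lambda>x. X x - (h + quadratic_vf a \<alpha> x)) \<in> L"
        by (intro closed_diff closed_add dderiv.prems subsetD[OF sub] const_conformal
            quadratic_vf_conformal \<alpha>)
      then have "A \<in> G" by (simp add: X G_def conformal_field_def algebra_simps)
      then show ?case using G_co X \<alpha> unfolding conformal_algebra_eq by blast
    qed
    then show False using L closed_poly by blast
  qed
  then have UNIV: "G = UNIV" using co_matrices_maximal[OF card G comm co] by blast
  have linear: "coordinate_field (\<lambda>x. x $ j) i \<in> L" for i j
    using UNIV by (auto simp: coordinate_field_matrix_unit G_def)
  show "L = poly_vec_fields"
  proof (rule eq_poly_vec_fields_if_quadratic[OF _ linear])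
    show "coordinate_field (\<lambda>x. 1) i \<in> L" for i
      using sub const_conformal by (auto simp: coordinate_field_def)
    show "coordinate_field (\<lambda>x. x $ j * x $ k) i \<in> L" for i j k
      using sub quadratic_vf_conformal[OF linear_coordinate]
      by (intro quadratic_coordinate_fields linear) blast
    show "CARD('n) > 1" using card by simp
  qed
qed

end

theorem mainTheorem2:
  fixes p q :: nat
    and idx :: "'n::finite \<Rightarrow> nat"
  assumes "bij_betw idx UNIV {1..p + q}"
    and "p + q > 2"
  shows "maximal_lie_subalgebra (conformal_algebra (signature_coeff p idx))"
proof -
  interpret orthonormal_signature "signature_coeff p idx"
    by unfold_locales (simp add: signature_coeff_def)
  have "CARD('n) = p + q" using bij_betw_same_card[OF assms(1)] by simp
  then show ?thesis using maximal_conformal_algebra assms(2) by simp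
qed

end
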